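(* Let $0<\delta<1$ and $0<\rho<\rho_{\mathrm{MSE}}(\delta)$. Assume the validity of the calibration relation between AMPT and LASSO, i.e. for every $\sigma>0$ and $\nu\in\mathcal F_{\delta\rho}$ the map $\tau\mapsto\lambda(\tau)=\theta_\infty(\tau)(1-\mathrm{EqDR}(\tau)/\delta)$ is a one-to-one correspondence between $\{\tau>0:\mathrm{fMSE}_{\mathrm{AMPT}}(\tau;\delta,\sigma,\nu)<\infty,\ \mathrm{EqDR}(\tau;\delta,\sigma,\nu)\le\delta\}$ and $[0,\infty)$, and the formal MSEs agree: $\mathrm{fMSE}_{\mathrm{LASSO}}(\lambda(\tau);\delta,\sigma,\nu)=\mathrm{fMSE}_{\mathrm{AMPT}}(\tau;\delta,\sigma,\nu)$. Define $$M^*(\delta,\rho)=\sup_{\sigma>0}\sup_{\nu\in\mathcal F_{\delta\rho}}\inf_{\lambda\ge0}\frac{\mathrm{fMSE}_{\mathrm{LASSO}}(\lambda;\delta,\sigma,\nu)}{\sigma^2},\qquad M^\flat(\delta,\rho)=\inf_{\tau>0}\sup_{\nu\in\mathcal F_{\delta\rho}}\mathrm{fMSE}_{\mathrm{AMPT}}(\tau;\delta,\sigma=1,\nu).$$ Then $$M^*(\delta,\rho)=M^\flat(\delta,\rho).$$ Also, for $$\lambda^*(\nu;\delta,\rho,\sigma)=\tau^{\pm}(\delta\rho)\,\sqrt{\mathrm{fNPI}(\tau^{\pm}(\delta\rho);\delta,\sigma,\nu)}\;\bigl(1-\mathrm{EqDR}(\tau^{\pm}(\delta\rho);\delta,\sigma,\nu)/\delta\bigr),$$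 one has, with $\sigma=1$, $$M^*(\delta,\rho)=\sup_{\nu\in\mathcal F_{\delta\rho}}\mathrm{fMSE}_{\mathrm{LASSO}}(\lambda^*(\nu;\delta,\rho,1);\delta,1,\nu).$$
   Context: Soft threshold: $\eta(x;\theta)=x-\theta$ if $x>\theta$, $0$ if $|x|\le\theta$, $x+\theta$ if $x<-\theta$. For $\varepsilon\in[0,1]$, $\mathcal F_\varepsilon$ is the set of probability measures $\nu$ on $\mathbb R$ with $\nu(\{0\})\ge1-\varepsilon$. Scalar risk: $\mathrm{mse}(s^2;\nu,\tau)=\mathbb E\{[\eta(X+sZ;\tau s)-X]^2\}$ with $X\sim\nu$, $Z\sim N(0,1)$ independent. Minimax threshold MSE: $M^{\pm}(\varepsilon)=\inf_{\tau>0}\sup_{\nu\in\mathcal F_\varepsilon}\mathrm{mse}(1;\nu,\tau)$; $\tau^{\pm}(\varepsilon)$ is the threshold attaining the infimum. The function $M^\pm$ is increasing and concave with $M^\pm(0)=0$, $M^\pm(1)=1$. Phase boundary: $\rho_{\mathrm{MSE}}(\delta)$ is the value of $\rho$ solving $M^{\pm}(\rho\delta)=\delta$. State evolution: $\mathrm{npi}(m;\sigma,\delta)=\sigma^2+m/\delta$; $\Psi(m)=\Psi(m,\delta,\sigma,\tau,\nu)=\mathrm{mse}(\mathrm{npi}(m;\sigma,\delta);\nu,\tau)$ for $m\ge0$; $\mathrm{HFP}(\Psi)=\sup\{m\ge0:\Psi(m)\ge m\}$ (possibly $+\infty$). The equilibrium formal MSE of the tunable approximate message passing algorithm AMPT$(\tau)$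 is $\mathrm{fMSE}_{\mathrm{AMPT}}(\tau;\delta,\sigma,\nu)=\mathrm{HFP}(\Psi)$; the formal noise-plus-interference level is $\mathrm{fNPI}(\tau;\delta,\sigma,\nu)=\sigma^2+\mathrm{fMSE}_{\mathrm{AMPT}}(\tau;\delta,\sigma,\nu)/\delta$. When it is finite, the equilibrium threshold is $\theta_\infty(\tau)=\tau\sqrt{\mathrm{fNPI}}$ and the equilibrium detection rate is $\mathrm{EqDR}(\tau;\delta,\sigma,\nu)=\mathbb P\{\eta(X+\sqrt{\mathrm{fNPI}}\,Z;\theta_\infty(\tau))\ne0\}$. LASSO$(\lambda)$ is the estimator minimizing $\frac12\|y-Ax\|_2^2+\lambda\|x\|_1$ from $y=Ax^0+z^0$; its formal MSE $\mathrm{fMSE}_{\mathrm{LASSO}}(\lambda;\delta,\sigma,\nu)$ is the quantity determined from $\mathrm{fMSE}_{\mathrm{AMPT}}$ by the calibration relation written in the claim. *)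

theory Defs
  imports "HOL-Probability.Probability"
begin

definition soft_threshold :: "real \<Rightarrow> real \<Rightarrow> real" where
  "soft_threshold x \<theta> =
     (if x > \<theta> then x - \<theta> else if x < - \<theta> then x + \<theta> else 0)"

definition sparse_priors :: "real \<Rightarrow> real measure set" where
  "sparse_priors \<epsilon> = {\<nu>. real_distribution \<nu> \<and> measure \<nu> {0} \<ge> 1 - \<epsilon>}"

text \<open>
  The joint law of a pair \<open>(X, Z)\<close> of independent variables with \<open>X\<close> distributed as \<open>\<nu>\<close>
  and \<open>Z\<close> standard normal.
\<close>

definition signal_noise :: "real measure \<Rightarrow> (real \<times> real) measure" where
  "signal_noise \<nu> = \<nu> \<Otimes>\<^sub>M std_normal_distribution"

text \<open>
  The first argument is the squared noise level. Risks and mean square errors are taken in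
  \<^typ>\<open>ennreal\<close>, so that expectations, suprema and infima need no side conditions.
\<close>

definition mse :: "real \<Rightarrow> real measure \<Rightarrow> real \<Rightarrow> ennreal" where
  "mse s2 \<nu> \<tau> =
     (\<integral>\<^sup>+ (x, z). ennreal ((soft_threshold (x + sqrt s2 * z) (\<tau> * sqrt s2) - x)\<^sup>2)
        \<partial>signal_noise \<nu>)"

definition minimax_mse :: "real \<Rightarrow> ennreal" where
  "minimax_mse \<epsilon> = (INF \<tau>\<in>{0<..}. SUP \<nu>\<in>sparse_priors \<epsilon>. mse 1 \<nu> \<tau>)"

definition minimax_threshold :: "real \<Rightarrow> real" where
  "minimax_threshold \<epsilon> =
     (THE \<tau>. \<tau> > 0 \<and> (SUP \<nu>\<in>sparse_priors \<epsilon>. mse 1 \<nu> \<tau>) = minimax_mse \<epsilon>)"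

definition rho_MSE :: "real \<Rightarrow> real" where
  "rho_MSE \<delta> = (THE \<rho>. \<rho> * \<delta> \<in> {0..1} \<and> minimax_mse (\<rho> * \<delta>) = ennreal \<delta>)"

definition npi :: "real \<Rightarrow> real \<Rightarrow> real \<Rightarrow> real" where
  "npi m \<sigma> \<delta> = \<sigma>\<^sup>2 + m / \<delta>"

definition mse_map :: "real \<Rightarrow> real \<Rightarrow> real \<Rightarrow> real \<Rightarrow> real measure \<Rightarrow> ennreal" where
  "mse_map m \<delta> \<sigma> \<tau> \<nu> = mse (npi m \<sigma> \<delta>) \<nu> \<tau>"

definition highest_fixed_point :: "(real \<Rightarrow> ennreal) \<Rightarrow> ennreal" where
  "highest_fixed_point \<Psi> = Sup {ennreal m | m. m \<ge> 0 \<and> \<Psi> m \<ge> ennreal m}"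

definition fMSE_AMPT :: "real \<Rightarrow> real \<Rightarrow> real \<Rightarrow> real measure \<Rightarrow> ennreal" where
  "fMSE_AMPT \<tau> \<delta> \<sigma> \<nu> = highest_fixed_point (\<lambda>m. mse_map m \<delta> \<sigma> \<tau> \<nu>)"

definition fNPI :: "real \<Rightarrow> real \<Rightarrow> real \<Rightarrow> real measure \<Rightarrow> ennreal" where
  "fNPI \<tau> \<delta> \<sigma> \<nu> = ennreal (\<sigma>\<^sup>2) + fMSE_AMPT \<tau> \<delta> \<sigma> \<nu> / ennreal \<delta>"

text \<open>
  The equilibrium threshold and detection rate, and the \<open>\<lambda>\<close> computed from them, are meaningful
  only when \<^const>\<open>fMSE_AMPT\<close> is finite; otherwise \<^const>\<open>enn2real\<close> returns the junk value 0.
\<close>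

definition eq_threshold :: "real \<Rightarrow> real \<Rightarrow> real \<Rightarrow> real measure \<Rightarrow> real" where
  "eq_threshold \<tau> \<delta> \<sigma> \<nu> = \<tau> * sqrt (enn2real (fNPI \<tau> \<delta> \<sigma> \<nu>))"

definition EqDR :: "real \<Rightarrow> real \<Rightarrow> real \<Rightarrow> real measure \<Rightarrow> real" where
  "EqDR \<tau> \<delta> \<sigma> \<nu> =
     \<P>((x, z) in signal_noise \<nu>.
        soft_threshold (x + sqrt (enn2real (fNPI \<tau> \<delta> \<sigma> \<nu>)) * z) (eq_threshold \<tau> \<delta> \<sigma> \<nu>) \<noteq> 0)"

definition calibrated_lambda :: "real \<Rightarrow> real \<Rightarrow> real \<Rightarrow> real measure \<Rightarrow> real" where
  "calibrated_lambda \<tau> \<delta> \<sigma> \<nu> = eq_threshold \<tau> \<delta> \<sigma> \<nu> * (1 - EqDR \<tau> \<delta> \<sigma> \<nu> / \<delta>)"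

definition lambda_star :: "real measure \<Rightarrow> real \<Rightarrow> real \<Rightarrow> real \<Rightarrow> real" where
  "lambda_star \<nu> \<delta> \<rho> \<sigma> =
     (let \<tau> = minimax_threshold (\<delta> * \<rho>)
      in \<tau> * sqrt (enn2real (fNPI \<tau> \<delta> \<sigma> \<nu>)) * (1 - EqDR \<tau> \<delta> \<sigma> \<nu> / \<delta>))"

definition calibration_domain :: "real \<Rightarrow> real \<Rightarrow> real measure \<Rightarrow> real set" where
  "calibration_domain \<delta> \<sigma> \<nu> =
     {\<tau>. \<tau> > 0 \<and> fMSE_AMPT \<tau> \<delta> \<sigma> \<nu> < \<infinity> \<and> EqDR \<tau> \<delta> \<sigma> \<nu> \<le> \<delta>}"

text \<open>
  The formal MSE of the LASSO has no definition of its own: it is any function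
  \<open>L\<close> of \<open>(\<lambda>, \<delta>, \<sigma>, \<nu>)\<close> satisfying the calibration relation, which determines it for \<open>\<lambda> \<ge> 0\<close>.
\<close>

definition calibration_valid ::
  "(real \<Rightarrow> real \<Rightarrow> real \<Rightarrow> real measure \<Rightarrow> ennreal) \<Rightarrow> real \<Rightarrow> real \<Rightarrow> bool" where
  "calibration_valid L \<delta> \<rho> \<longleftrightarrow>
     (\<forall>\<sigma>>0. \<forall>\<nu>\<in>sparse_priors (\<delta> * \<rho>).
        bij_betw (\<lambda>\<tau>. calibrated_lambda \<tau> \<delta> \<sigma> \<nu>) (calibration_domain \<delta> \<sigma> \<nu>) {0..} \<and>
        (\<forall>\<tau>\<in>calibration_domain \<delta> \<sigma> \<nu>.
           L (calibrated_lambda \<tau> \<delta> \<sigma> \<nu>) \<delta> \<sigma> \<nu> = fMSE_AMPT \<tau> \<delta> \<sigma> \<nu>))"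

definition M_star ::
  "(real \<Rightarrow> real \<Rightarrow> real \<Rightarrow> real measure \<Rightarrow> ennreal) \<Rightarrow> real \<Rightarrow> real \<Rightarrow> ennreal" where
  "M_star L \<delta> \<rho> =
     (SUP \<sigma>\<in>{0<..}. SUP \<nu>\<in>sparse_priors (\<delta> * \<rho>). INF l\<in>{0..}. L l \<delta> \<sigma> \<nu> / ennreal (\<sigma>\<^sup>2))"

definition M_flat :: "real \<Rightarrow> real \<Rightarrow> ennreal" where
  "M_flat \<delta> \<rho> = (INF \<tau>\<in>{0<..}. SUP \<nu>\<in>sparse_priors (\<delta> * \<rho>). fMSE_AMPT \<tau> \<delta> 1 \<nu>)"

end

theory Submission
  imports Defs "HOL-Real_Asymp.Real_Asymp"
begin

text \<open>
  Let \<open>\<epsilon> = \<delta> \<rho>\<close> and let \<open>M < \<delta>\<close> be the minimax threshold risk at sparsity \<open>\<epsilon>\<close>. All three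
  quantities equal \<open>M / (1 - M / \<delta>)\<close>. Upper bound: by scaling, the state evolution map at the
  minimax threshold lies below \<open>(\<sigma>\<^sup>2 + m / \<delta>) M\<close>, so its highest fixed point is at most
  \<open>\<sigma>\<^sup>2 M / (1 - M / \<delta>)\<close>. The minimax threshold is admissible for calibration because
  stationarity of the worst-case risk together with Stein's identity shows that \<open>M\<close> is also
  the worst-case detection rate, hence \<open>EqDR \<le> M < \<delta>\<close>. Lower bound: a spike of mass \<open>\<epsilon>\<close> far from
  the origin, on the scale of the equilibrium noise level, is nearly least favorable uniformly in
  the threshold, so it forces a fixed point close to \<open>M / (1 - M / \<delta>)\<close> for every \<open>\<tau>\<close> and
  therefore for every \<open>\<lambda> \<ge> 0\<close>.
\<close>

section \<open>Risk of soft thresholding\<close>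

lemma borel_measurable_soft_threshold [measurable (raw)]:
  assumes "f \<in> borel_measurable M" "g \<in> borel_measurable M"
  shows "(\<lambda>x. soft_threshold (f x) (g x)) \<in> borel_measurable M"
  using assms unfolding soft_threshold_def by measurable

lemma soft_threshold_scale:
  "0 < s \<Longrightarrow> soft_threshold (s * y) (s * \<tau>) = s * soft_threshold y \<tau>"
proof -
  assume s: "0 < s"
  have "s * \<tau> < s * y \<longleftrightarrow> \<tau> < y" "s * y < - (s * \<tau>) \<longleftrightarrow> y < - \<tau>"
    using s mult_less_cancel_left_pos[of s y "-\<tau>"] by auto
  then show ?thesis
    by (simp add: soft_threshold_def algebra_simps)
qed

lemma soft_threshold_sq: "0 \<le> \<tau> \<Longrightarrow> (soft_threshold z \<tau>)\<^sup>2 = (max (\<bar>z\<bar> - \<tau>) 0)\<^sup>2"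
proof -
  assume "0 \<le> \<tau>"
  then have "\<bar>soft_threshold z \<tau>\<bar> = max (\<bar>z\<bar> - \<tau>) 0"
    by (auto simp: soft_threshold_def)
  then show ?thesis by (metis power2_abs)
qed

text \<open>
  The clipping error \<open>soft_threshold y \<tau> - y\<close> is nonincreasing in \<open>y\<close>, so in the cross term
  it may be frozen at \<open>y = x\<close>; this makes the bound \<open>1 + \<tau>\<^sup>2\<close> on the risk a matter of moments.
\<close>

lemma soft_threshold_error_le:
  assumes "0 \<le> \<tau>"
  shows "(soft_threshold (x + z) \<tau> - x)\<^sup>2 \<le> z\<^sup>2 + 2 * z * (soft_threshold x \<tau> - x) + \<tau>\<^sup>2"
proof -
  define h where "h y = soft_threshold y \<tau> - y" for y
  have "\<bar>h (x + z)\<bar> \<le> \<tau>"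
    using assms by (auto simp: h_def soft_threshold_def)
  then have "(h (x + z))\<^sup>2 \<le> \<tau>\<^sup>2"
    using assms abs_le_square_iff[of "h (x + z)" \<tau>] by simp
  moreover have "z * (h (x + z) - h x) \<le> 0"
  proof (cases "0 \<le> z")
    case True
    then have "h (x + z) \<le> h x"
      using assms by (auto simp: h_def soft_threshold_def)
    with True show ?thesis by (simp add: mult_nonneg_nonpos)
  next
    case False
    then have "h x \<le> h (x + z)"
      using assms by (auto simp: h_def soft_threshold_def)
    with False show ?thesis by (simp add: mult_nonpos_nonneg)
  qed
  moreover have "(soft_threshold (x + z) \<tau> - x)\<^sup>2 = z\<^sup>2 + 2 * z * h (x + z) + (h (x + z))\<^sup>2"
    by (simp add: h_def power2_eq_square algebra_simps)
  ultimately show ?thesis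
    by (simp add: h_def algebra_simps)
qed

text \<open>Above the threshold the error is exactly \<open>z - \<tau>\<close>. Otherwise
  \<open>z \<le> - K\<close>, and the subtracted term carries a factor
  \<open>z\<^sup>2 / K\<^sup>2 \<ge> 1\<close>, so it dominates \<open>(z - \<tau>)\<^sup>2\<close>.
  The bound is polynomial in \<open>z\<close> and integrates through moments.\<close>

lemma soft_threshold_error_ge_of_spike:
  assumes "0 \<le> \<tau>" "\<tau> \<le> T" "0 < K"
  shows "(z - \<tau>)\<^sup>2 - 2 * (z ^ 4 + T\<^sup>2 * z\<^sup>2) / K\<^sup>2 \<le> (soft_threshold (T + K + z) \<tau> - (T + K))\<^sup>2"
proof (cases "\<tau> < T + K + z")
  case True
  then have "soft_threshold (T + K + z) \<tau> - (T + K) = z - \<tau>"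
    by (simp add: soft_threshold_def)
  then show ?thesis by simp
next
  case False
  then have "K \<le> - z" using assms by simp
  then have K: "K\<^sup>2 \<le> z\<^sup>2" using assms power_mono[of K "-z" 2] by simp
  have "\<tau>\<^sup>2 \<le> T\<^sup>2" using assms by (simp add: power_mono)
  moreover have "(z - \<tau>)\<^sup>2 \<le> 2 * (z\<^sup>2 + \<tau>\<^sup>2)"
    using zero_le_power2[of "z + \<tau>"] by (simp add: power2_eq_square algebra_simps)
  ultimately have "(z - \<tau>)\<^sup>2 \<le> 2 * (z\<^sup>2 + T\<^sup>2)"
    by simp
  moreover have "2 * (z\<^sup>2 + T\<^sup>2) * K\<^sup>2 \<le> 2 * (z\<^sup>2 + T\<^sup>2) * z\<^sup>2"
    using K by (intro mult_left_mono) auto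
  then have "2 * (z\<^sup>2 + T\<^sup>2) \<le> 2 * (z ^ 4 + T\<^sup>2 * z\<^sup>2) / K\<^sup>2"
    using assms(3) by (simp add: pos_le_divide_eq power2_eq_square power4_eq_xxxx algebra_simps)
  ultimately show ?thesis
    using zero_le_power2[of "soft_threshold (T + K + z) \<tau> - (T + K)"] by linarith
qed

text \<open>If \<open>\<bar>z\<bar> < T / 2\<close>, thresholding either returns 0, losing
  \<open>\<mu> \<ge> T\<close>, or shrinks by \<open>\<tau> \<ge> T\<close>, of which the noise can
  undo at most half. Otherwise the left-hand side is at most 0.\<close>

lemma soft_threshold_error_ge_of_large:
  assumes "0 \<le> T" "T \<le> \<tau>" "T \<le> \<mu>"
  shows "T\<^sup>2 / 4 - z\<^sup>2 \<le> (soft_threshold (\<mu> + z) \<tau> - \<mu>)\<^sup>2"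
proof (cases "\<bar>z\<bar> < T / 2")
  case True
  have "T / 2 \<le> \<bar>soft_threshold (\<mu> + z) \<tau> - \<mu>\<bar>"
    using assms True by (auto simp: soft_threshold_def)
  then have "(T / 2)\<^sup>2 \<le> \<bar>soft_threshold (\<mu> + z) \<tau> - \<mu>\<bar>\<^sup>2"
    using assms by (intro power_mono) auto
  then have "T\<^sup>2 / 4 \<le> (soft_threshold (\<mu> + z) \<tau> - \<mu>)\<^sup>2"
    by (simp add: power_divide)
  then show ?thesis using zero_le_power2[of z] by linarith
next
  case False
  then have "(T / 2)\<^sup>2 \<le> \<bar>z\<bar>\<^sup>2"
    using assms by (intro power_mono) auto
  then have "T\<^sup>2 / 4 \<le> z\<^sup>2"
    by (simp add: power_divide)
  then show ?thesis using zero_le_power2[of "soft_threshold (\<mu> + z) \<tau> - \<mu>"] by linarith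
qed

section \<open>Gaussian moments and the risk at a fixed signal\<close>

interpretation std_normal: prob_space std_normal_distribution
  by (simp add: prob_space_normal_density)

lemma std_normal_prob_UNIV [simp]: "measure std_normal_distribution UNIV = 1"
  using std_normal.prob_space by simp

lemma std_normal_integrable [simp]:
  "integrable std_normal_distribution (\<lambda>z. z)"
  "integrable std_normal_distribution (\<lambda>z. z\<^sup>2)"
  "integrable std_normal_distribution (\<lambda>z. z ^ 4)"
  using integrable_std_normal_distribution_moment[of 1] integrable_std_normal_distribution_moment
  by simp_all

lemma std_normal_moments [simp]:
  "(LINT z|std_normal_distribution. z) = 0"
  "(LINT z|std_normal_distribution. z\<^sup>2) = 1"
  "(LINT z|std_normal_distribution. z ^ 4) = 3"
  using integral_std_normal_distribution_moment_odd[of 1]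
    std_normal_distribution_even_moments(1)[of 1] std_normal_distribution_even_moments(1)[of 2]
  by (simp_all add: fact_numeral)

definition scalar_risk :: "real \<Rightarrow> real \<Rightarrow> real" where
  "scalar_risk x \<tau> = (LINT z|std_normal_distribution. (soft_threshold (x + z) \<tau> - x)\<^sup>2)"

lemma scalar_risk_integrable:
  assumes "0 \<le> \<tau>"
  shows "integrable std_normal_distribution (\<lambda>z. (soft_threshold (x + z) \<tau> - x)\<^sup>2)"
proof (rule Bochner_Integration.integrable_bound)
  show "integrable std_normal_distribution (\<lambda>z. z\<^sup>2 + 2 * z * (soft_threshold x \<tau> - x) + \<tau>\<^sup>2)"
    by (simp add: mult.assoc)
  show "(\<lambda>z. (soft_threshold (x + z) \<tau> - x)\<^sup>2) \<in> borel_measurable std_normal_distribution"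
    by measurable
  show "AE z in std_normal_distribution. norm ((soft_threshold (x + z) \<tau> - x)\<^sup>2)
      \<le> norm (z\<^sup>2 + 2 * z * (soft_threshold x \<tau> - x) + \<tau>\<^sup>2)"
  proof (rule AE_I2)
    fix z
    show "norm ((soft_threshold (x + z) \<tau> - x)\<^sup>2)
        \<le> norm (z\<^sup>2 + 2 * z * (soft_threshold x \<tau> - x) + \<tau>\<^sup>2)"
      using soft_threshold_error_le[OF assms, of x z] by simp
  qed
qed

lemma scalar_risk_nonneg: "0 \<le> scalar_risk x \<tau>"
  by (simp add: scalar_risk_def)

lemma nn_integral_scalar_risk:
  assumes "0 \<le> \<tau>"
  shows "(\<integral>\<^sup>+z. ennreal ((soft_threshold (x + z) \<tau> - x)\<^sup>2) \<partial>std_normal_distribution)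
    = ennreal (scalar_risk x \<tau>)"
  unfolding scalar_risk_def
  by (rule nn_integral_eq_integral[OF scalar_risk_integrable[OF assms]]) simp

lemma scalar_risk_le:
  assumes "0 \<le> \<tau>"
  shows "scalar_risk x \<tau> \<le> 1 + \<tau>\<^sup>2"
proof -
  have "scalar_risk x \<tau>
      \<le> (LINT z|std_normal_distribution. z\<^sup>2 + 2 * (soft_threshold x \<tau> - x) * z + \<tau>\<^sup>2)"
    unfolding scalar_risk_def
    using soft_threshold_error_le[OF assms, of x]
    by (intro integral_mono scalar_risk_integrable assms) (auto simp: mult_ac)
  also have "\<dots> = 1 + \<tau>\<^sup>2"
    by simp
  finally show ?thesis .
qed

lemma scalar_risk_spike_ge:
  assumes "0 \<le> \<tau>" "\<tau> \<le> T" "0 < K"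
  shows "1 + \<tau>\<^sup>2 - (6 + 2 * T\<^sup>2) / K\<^sup>2 \<le> scalar_risk (T + K) \<tau>"
proof -
  \<comment> \<open>Sorted by powers of \<open>z\<close>, so that the second and fourth moments 1
    and 3 produce the constant \<open>6 + 2 * T\<^sup>2\<close>.\<close>
  have eq: "(z - \<tau>)\<^sup>2 - 2 * (z ^ 4 + T\<^sup>2 * z\<^sup>2) / K\<^sup>2
      = (1 - 2 * T\<^sup>2 / K\<^sup>2) * z\<^sup>2 - 2 * \<tau> * z + \<tau>\<^sup>2 - (2 / K\<^sup>2) * z ^ 4" for z
    by (simp add: power2_eq_square algebra_simps add_divide_distrib)
  have "1 + \<tau>\<^sup>2 - (6 + 2 * T\<^sup>2) / K\<^sup>2
      = (LINT z|std_normal_distribution. (1 - 2 * T\<^sup>2 / K\<^sup>2) * z\<^sup>2 - 2 * \<tau> * z + \<tau>\<^sup>2 - (2 / K\<^sup>2) * z ^ 4)"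
    by (simp add: add_divide_distrib)
  also have "\<dots> \<le> scalar_risk (T + K) \<tau>"
    unfolding scalar_risk_def
    using soft_threshold_error_ge_of_spike[OF assms, unfolded eq]
    by (intro integral_mono scalar_risk_integrable assms) auto
  finally show ?thesis .
qed

lemma scalar_risk_large_ge:
  assumes "0 \<le> T" "T \<le> \<tau>" "T \<le> \<mu>"
  shows "T\<^sup>2 / 4 - 1 \<le> scalar_risk \<mu> \<tau>"
proof -
  have "T\<^sup>2 / 4 - 1 = (LINT z|std_normal_distribution. T\<^sup>2 / 4 - z\<^sup>2)"
    by simp
  also have "\<dots> \<le> scalar_risk \<mu> \<tau>"
    unfolding scalar_risk_def
    using soft_threshold_error_ge_of_large[OF assms] assms
    by (intro integral_mono scalar_risk_integrable) auto
  finally show ?thesis .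
qed

text \<open>The order of quantifiers is the point: one \<open>\<mu>\<close> serves all thresholds.
  Up to \<open>T\<close> its risk is within \<open>e\<close> of the upper bound
  \<open>1 + \<tau>\<^sup>2\<close>; beyond \<open>T\<close> the shrinkage bias alone is
  costly.\<close>

lemma scalar_risk_spike_uniform:
  assumes "0 \<le> T" "0 < e"
  obtains \<mu> where "\<And>\<tau>. 0 \<le> \<tau> \<Longrightarrow> \<tau> \<le> T \<Longrightarrow> 1 + \<tau>\<^sup>2 - e \<le> scalar_risk \<mu> \<tau>"
    and "\<And>\<tau>. T \<le> \<tau> \<Longrightarrow> T\<^sup>2 / 4 - 1 \<le> scalar_risk \<mu> \<tau>"
proof -
  \<comment> \<open>Chosen to make the correction in \<open>scalar_risk_spike_ge\<close> equal to
    \<open>e\<close>.\<close>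
  define K where "K = sqrt ((6 + 2 * T\<^sup>2) / e)"
  have pos: "0 < 6 + 2 * T\<^sup>2"
    by (smt (verit) zero_le_power2)
  then have K: "0 < K" "(6 + 2 * T\<^sup>2) / K\<^sup>2 = e"
    using assms by (auto simp: K_def)
  show thesis
    using scalar_risk_spike_ge[of _ T K] scalar_risk_large_ge[of T _ "T + K"] K assms
    by (intro that[of "T + K"]) auto
qed

text \<open>Threshold and noise share the factor \<open>sqrt s2\<close>; dividing it out leaves unit
  noise and the factor \<open>s2\<close> on the squared error. Tonelli then integrates out the
  noise.\<close>

lemma mse_eq_scalar_risk:
  assumes "0 < s2" "0 \<le> \<tau>" "real_distribution \<nu>"
  shows "mse s2 \<nu> \<tau> = (\<integral>\<^sup>+x. ennreal (s2 * scalar_risk (x / sqrt s2) \<tau>) \<partial>\<nu>)"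
proof -
  interpret \<nu>: real_distribution \<nu> by fact
  define s where "s = sqrt s2"
  have s: "0 < s" "s2 = s\<^sup>2" using assms by (auto simp: s_def)
  have scale: "(soft_threshold (x + s * z) (\<tau> * s) - x)\<^sup>2
      = s2 * (soft_threshold (x / s + z) \<tau> - x / s)\<^sup>2" for x z
  proof -
    have "soft_threshold (x + s * z) (\<tau> * s) = s * soft_threshold (x / s + z) \<tau>"
      using soft_threshold_scale[of s "x / s + z" \<tau>] s by (simp add: algebra_simps)
    then have "soft_threshold (x + s * z) (\<tau> * s) - x = s * (soft_threshold (x / s + z) \<tau> - x / s)"
      using s by (simp add: algebra_simps)
    then show ?thesis by (simp add: s power_mult_distrib)
  qed
  have "mse s2 \<nu> \<tau> = (\<integral>\<^sup>+x. \<integral>\<^sup>+z. ennreal ((soft_threshold (x + s * z) (\<tau> * s) - x)\<^sup>2)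
      \<partial>std_normal_distribution \<partial>\<nu>)"
    unfolding mse_def signal_noise_def s_def
    by (subst std_normal.nn_integral_fst[symmetric]) (auto simp: split_beta')
  also have "\<dots> = (\<integral>\<^sup>+x. ennreal (s2 * scalar_risk (x / s) \<tau>) \<partial>\<nu>)"
    unfolding scale using assms
    by (simp add: ennreal_mult nn_integral_cmult nn_integral_scalar_risk scalar_risk_nonneg)
  finally show ?thesis by (simp add: s_def)
qed

text \<open>Closed form of the supremum over sparse priors: mass \<open>1 - \<epsilon>\<close> sits
  at 0 and the rest escapes to infinity, where the risk approaches
  \<open>1 + \<tau>\<^sup>2\<close>. It is affine in \<open>\<epsilon>\<close>.\<close>

definition worst_risk :: "real \<Rightarrow> real \<Rightarrow> real" where
  "worst_risk \<epsilon> \<tau> = (1 - \<epsilon>) * scalar_risk 0 \<tau> + \<epsilon> * (1 + \<tau>\<^sup>2)"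

lemma worst_risk_nonneg: "0 \<le> \<epsilon> \<Longrightarrow> \<epsilon> \<le> 1 \<Longrightarrow> 0 \<le> worst_risk \<epsilon> \<tau>"
  by (simp add: worst_risk_def scalar_risk_nonneg)

text \<open>A prior may put more than \<open>1 - \<epsilon>\<close> at 0; moving the surplus from
  the value \<open>a\<close> to the larger \<open>b\<close> only raises the mean. Serves both the
  risk and the detection rate.\<close>

lemma sparse_prior_convex_bound:
  fixes a b p \<epsilon> :: real
  assumes "a \<le> b" "1 - \<epsilon> \<le> p"
  shows "p * a + (1 - p) * b \<le> (1 - \<epsilon>) * a + \<epsilon> * b"
proof -
  have "0 \<le> (p - (1 - \<epsilon>)) * (b - a)" using assms by simp
  then show ?thesis by (simp add: algebra_simps)
qed

lemma mse_le_worst_risk: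
  assumes "0 < s2" "0 \<le> \<tau>" "\<nu> \<in> sparse_priors \<epsilon>"
  shows "mse s2 \<nu> \<tau> \<le> ennreal (s2 * worst_risk \<epsilon> \<tau>)"
proof -
  interpret \<nu>: real_distribution \<nu> using assms by (simp add: sparse_priors_def)
  define p where "p = measure \<nu> {0}"
  have p: "1 - \<epsilon> \<le> p" "0 \<le> p" "p \<le> 1" using assms by (auto simp: sparse_priors_def p_def)
  let ?a = "scalar_risk 0 \<tau>" and ?b = "1 + \<tau>\<^sup>2"
  have "mse s2 \<nu> \<tau> = (\<integral>\<^sup>+x. ennreal (s2 * scalar_risk (x / sqrt s2) \<tau>) \<partial>\<nu>)"
    using assms \<nu>.real_distribution_axioms by (intro mse_eq_scalar_risk)
  \<comment> \<open>With the exact risk at 0 and the uniform bound elsewhere, the prior enters only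
    through its mass at 0.\<close>
  also have "\<dots> \<le> (\<integral>\<^sup>+x. ennreal (s2 * ?a) * indicator {0} x + ennreal (s2 * ?b) * indicator (UNIV - {0}) x \<partial>\<nu>)"
    using scalar_risk_le[OF assms(2)] assms
    by (intro nn_integral_mono) (auto simp: indicator_def intro!: ennreal_leI)
  also have "\<dots> = ennreal (s2 * ?a) * emeasure \<nu> {0} + ennreal (s2 * ?b) * emeasure \<nu> (UNIV - {0})"
    by (subst nn_integral_add) (auto simp: nn_integral_cmult_indicator)
  also have "emeasure \<nu> {0} = ennreal p"
    by (simp add: p_def \<nu>.emeasure_eq_measure)
  also have "emeasure \<nu> (UNIV - {0}) = ennreal (1 - p)"
    using \<nu>.prob_compl[of "{0}"] by (simp add: p_def \<nu>.emeasure_eq_measure)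
  also have "ennreal (s2 * ?a) * ennreal p + ennreal (s2 * ?b) * ennreal (1 - p)
      = ennreal (s2 * (p * ?a + (1 - p) * ?b))"
  proof -
    have "s2 * (p * ?a + (1 - p) * ?b) = s2 * ?a * p + s2 * ?b * (1 - p)"
      by (simp add: algebra_simps)
    then show ?thesis
      using p assms by (simp only:) (simp add: ennreal_mult scalar_risk_nonneg)
  qed
  also have "\<dots> \<le> ennreal (s2 * worst_risk \<epsilon> \<tau>)"
    unfolding worst_risk_def using assms p
    by (intro ennreal_leI mult_left_mono sparse_prior_convex_bound scalar_risk_le) auto
  finally show ?thesis .
qed

definition spike_prior :: "real \<Rightarrow> real \<Rightarrow> real measure" where
  "spike_prior \<epsilon> \<mu> = distr (measure_pmf (bernoulli_pmf \<epsilon>)) borel (\<lambda>b. if b then \<mu> else 0)"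

lemma spike_prior_sparse:
  assumes "0 \<le> \<epsilon>" "\<epsilon> \<le> 1"
  shows "spike_prior \<epsilon> \<mu> \<in> sparse_priors \<epsilon>"
proof -
  have "1 - \<epsilon> = measure (measure_pmf (bernoulli_pmf \<epsilon>)) {False}"
    using assms by (simp add: measure_pmf_single)
  \<comment> \<open>Only an inequality, since for \<open>\<mu> = 0\<close> all the mass sits at
    0.\<close>
  also have "\<dots> \<le> measure (spike_prior \<epsilon> \<mu>) {0}"
    unfolding spike_prior_def
    by (subst measure_distr) (auto intro!: measure_pmf.finite_measure_mono)
  finally show ?thesis
    unfolding sparse_priors_def spike_prior_def
    by (auto simp: real_distribution_def real_distribution_axioms_def
        intro!: measure_pmf.prob_space_distr)
qed

text \<open>The spike is positioned in units of the noise level, so the normalized risk is the same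
  for every \<open>s2\<close>.\<close>

lemma mse_spike_prior:
  assumes "0 \<le> \<epsilon>" "\<epsilon> \<le> 1" "0 < s2" "0 \<le> \<tau>"
  shows "mse s2 (spike_prior \<epsilon> (sqrt s2 * \<mu>)) \<tau>
    = ennreal (s2 * ((1 - \<epsilon>) * scalar_risk 0 \<tau> + \<epsilon> * scalar_risk \<mu> \<tau>))"
proof -
  have [measurable]: "(\<lambda>x. scalar_risk (x / sqrt s2) \<tau>) \<in> borel_measurable borel"
    unfolding scalar_risk_def by measurable
  have "mse s2 (spike_prior \<epsilon> (sqrt s2 * \<mu>)) \<tau>
      = (\<integral>\<^sup>+x. ennreal (s2 * scalar_risk (x / sqrt s2) \<tau>) \<partial>spike_prior \<epsilon> (sqrt s2 * \<mu>))"
    using spike_prior_sparse[OF assms(1,2)] assms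
    by (intro mse_eq_scalar_risk) (auto simp: sparse_priors_def)
  also have "\<dots> = ennreal (s2 * ((1 - \<epsilon>) * scalar_risk 0 \<tau> + \<epsilon> * scalar_risk \<mu> \<tau>))"
  proof -
    have "s2 * ((1 - \<epsilon>) * scalar_risk 0 \<tau> + \<epsilon> * scalar_risk \<mu> \<tau>)
        = s2 * scalar_risk \<mu> \<tau> * \<epsilon> + s2 * scalar_risk 0 \<tau> * (1 - \<epsilon>)"
      by (simp add: algebra_simps)
    then show ?thesis
      using assms unfolding spike_prior_def
      by (simp only:) (subst nn_integral_distr, auto simp: scalar_risk_nonneg ennreal_mult)
  qed
  finally show ?thesis .
qed

text \<open>Two-point priors with ever more distant spikes approach the bound of
  \<open>mse_le_worst_risk\<close>.\<close>

lemma SUP_mse_eq_worst_risk: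
  assumes "0 \<le> \<epsilon>" "\<epsilon> \<le> 1" "0 \<le> \<tau>"
  shows "(SUP \<nu>\<in>sparse_priors \<epsilon>. mse 1 \<nu> \<tau>) = ennreal (worst_risk \<epsilon> \<tau>)"
proof (rule antisym)
  show "(SUP \<nu>\<in>sparse_priors \<epsilon>. mse 1 \<nu> \<tau>) \<le> ennreal (worst_risk \<epsilon> \<tau>)"
    using mse_le_worst_risk[of 1 \<tau> _ \<epsilon>] assms by (intro SUP_least) auto
  show "ennreal (worst_risk \<epsilon> \<tau>) \<le> (SUP \<nu>\<in>sparse_priors \<epsilon>. mse 1 \<nu> \<tau>)"
  proof (rule ennreal_le_epsilon)
    fix e :: real
    assume e: "0 < e"
    obtain \<mu> where \<mu>: "\<And>t. 0 \<le> t \<Longrightarrow> t \<le> \<tau> \<Longrightarrow> 1 + t\<^sup>2 - e \<le> scalar_risk \<mu> t"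
      using scalar_risk_spike_uniform[OF assms(3) e] by metis
    let ?r = "(1 - \<epsilon>) * scalar_risk 0 \<tau> + \<epsilon> * scalar_risk \<mu> \<tau>"
    have "\<epsilon> * (1 + \<tau>\<^sup>2 - e) \<le> \<epsilon> * scalar_risk \<mu> \<tau>" "\<epsilon> * e \<le> 1 * e"
      using \<mu>[of \<tau>] assms e by (intro mult_left_mono mult_right_mono; auto)+
    then have "worst_risk \<epsilon> \<tau> \<le> ?r + e"
      by (simp add: worst_risk_def algebra_simps)
    then have "ennreal (worst_risk \<epsilon> \<tau>) \<le> ennreal ?r + ennreal e"
      using e assms by (simp add: scalar_risk_nonneg ennreal_plus[symmetric] ennreal_leI del: ennreal_plus)
    also have "ennreal ?r = mse 1 (spike_prior \<epsilon> \<mu>) \<tau>"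
      using mse_spike_prior[of \<epsilon> 1 \<tau> \<mu>] assms by simp
    also have "\<dots> \<le> (SUP \<nu>\<in>sparse_priors \<epsilon>. mse 1 \<nu> \<tau>)"
      using assms by (intro SUP_upper spike_prior_sparse)
    finally show "ennreal (worst_risk \<epsilon> \<tau>) \<le> (SUP \<nu>\<in>sparse_priors \<epsilon>. mse 1 \<nu> \<tau>) + ennreal e"
      by (simp add: add_right_mono)
  qed
qed

section \<open>The minimax risk\<close>

definition minimax_risk :: "real \<Rightarrow> real" where
  "minimax_risk \<epsilon> = (INF \<tau>\<in>{0<..}. worst_risk \<epsilon> \<tau>)"

lemma minimax_risk_le:
  assumes "0 \<le> \<epsilon>" "\<epsilon> \<le> 1" "0 < \<tau>"
  shows "minimax_risk \<epsilon> \<le> worst_risk \<epsilon> \<tau>"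
  unfolding minimax_risk_def using assms worst_risk_nonneg
  by (intro cINF_lower) (auto intro!: bdd_belowI2[of _ 0])

lemma minimax_risk_greatest:
  "(\<And>\<tau>. 0 < \<tau> \<Longrightarrow> c \<le> worst_risk \<epsilon> \<tau>) \<Longrightarrow> c \<le> minimax_risk \<epsilon>"
  unfolding minimax_risk_def by (intro cINF_greatest) auto

lemma minimax_risk_nonneg: "0 \<le> \<epsilon> \<Longrightarrow> \<epsilon> \<le> 1 \<Longrightarrow> 0 \<le> minimax_risk \<epsilon>"
  by (intro minimax_risk_greatest worst_risk_nonneg)

lemma minimax_risk_approx:
  assumes "minimax_risk \<epsilon> < c"
  obtains \<tau> where "0 < \<tau>" "worst_risk \<epsilon> \<tau> < c"
  using assms minimax_risk_greatest[of c \<epsilon>] by (meson not_le)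

lemma worst_risk_le_one_plus:
  "0 \<le> \<epsilon> \<Longrightarrow> \<epsilon> \<le> 1 \<Longrightarrow> 0 \<le> \<tau> \<Longrightarrow> worst_risk \<epsilon> \<tau> \<le> 1 + \<tau>\<^sup>2"
  using mult_left_mono[OF scalar_risk_le[of \<tau> 0], of "1 - \<epsilon>"]
  by (simp add: worst_risk_def algebra_simps)

text \<open>As the threshold tends to 0 the estimator tends to the identity, of risk 1;
  \<open>sqrt e\<close> makes the excess at most \<open>e\<close>.\<close>

lemma minimax_risk_le_1:
  assumes "0 \<le> \<epsilon>" "\<epsilon> \<le> 1"
  shows "minimax_risk \<epsilon> \<le> 1"
proof (rule field_le_epsilon)
  fix e :: real
  assume "0 < e"
  then show "minimax_risk \<epsilon> \<le> 1 + e"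
    using minimax_risk_le[OF assms, of "sqrt e"] worst_risk_le_one_plus[OF assms, of "sqrt e"] by simp
qed

lemma minimax_risk_1: "minimax_risk 1 = 1"
  using minimax_risk_greatest[of 1 1] minimax_risk_le_1[of 1]
  by (force simp: worst_risk_def)

lemma minimax_mse_eq:
  assumes "0 \<le> \<epsilon>" "\<epsilon> \<le> 1"
  shows "minimax_mse \<epsilon> = ennreal (minimax_risk \<epsilon>)"
proof -
  have "minimax_mse \<epsilon> = (INF \<tau>\<in>{0<..}. ennreal (worst_risk \<epsilon> \<tau>))"
    unfolding minimax_mse_def using assms by (intro INF_cong) (auto simp: SUP_mse_eq_worst_risk)
  also have "\<dots> = ennreal (minimax_risk \<epsilon>)"
  proof (rule antisym)
    show "(INF \<tau>\<in>{0<..}. ennreal (worst_risk \<epsilon> \<tau>)) \<le> ennreal (minimax_risk \<epsilon>)"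
    proof (rule ennreal_le_epsilon)
      fix e :: real
      assume e: "0 < e"
      obtain \<tau> where \<tau>: "0 < \<tau>" "worst_risk \<epsilon> \<tau> < minimax_risk \<epsilon> + e"
        using minimax_risk_approx[of \<epsilon> "minimax_risk \<epsilon> + e"] e by auto
      then have "(INF \<tau>\<in>{0<..}. ennreal (worst_risk \<epsilon> \<tau>)) \<le> ennreal (minimax_risk \<epsilon> + e)"
        by (intro INF_lower2[of \<tau>] ennreal_leI) auto
      then show "(INF \<tau>\<in>{0<..}. ennreal (worst_risk \<epsilon> \<tau>)) \<le> ennreal (minimax_risk \<epsilon>) + ennreal e"
        using e minimax_risk_nonneg[OF assms] by simp
    qed
    show "ennreal (minimax_risk \<epsilon>) \<le> (INF \<tau>\<in>{0<..}. ennreal (worst_risk \<epsilon> \<tau>))"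
      using minimax_risk_le[OF assms] by (intro INF_greatest ennreal_leI) auto
  qed
  finally show ?thesis .
qed

text \<open>An infimum of functions affine in the sparsity is concave.\<close>

lemma minimax_risk_concave:
  assumes "0 \<le> a" "a \<le> 1" "0 \<le> b" "b \<le> 1" "0 \<le> t" "t \<le> 1"
  shows "(1 - t) * minimax_risk a + t * minimax_risk b \<le> minimax_risk ((1 - t) * a + t * b)"
proof (rule minimax_risk_greatest)
  fix \<tau> :: real
  assume \<tau>: "0 < \<tau>"
  have "(1 - t) * minimax_risk a + t * minimax_risk b \<le> (1 - t) * worst_risk a \<tau> + t * worst_risk b \<tau>"
    using assms \<tau> by (intro add_mono mult_left_mono minimax_risk_le) auto
  also have "\<dots> = worst_risk ((1 - t) * a + t * b) \<tau>"
    by (simp add: worst_risk_def algebra_simps)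
  finally show "(1 - t) * minimax_risk a + t * minimax_risk b \<le> worst_risk ((1 - t) * a + t * b) \<tau>" .
qed

text \<open>Concavity on \<open>[a, 1]\<close>, where \<open>minimax_risk 1 = 1\<close>.\<close>

lemma minimax_risk_increase:
  assumes "0 \<le> a" "a < b" "b \<le> 1"
  shows "minimax_risk a + (b - a) / (1 - a) * (1 - minimax_risk a) \<le> minimax_risk b"
proof -
  define t where "t = (b - a) / (1 - a)"
  have "t * (1 - a) = b - a" "0 \<le> t" "t \<le> 1" using assms by (auto simp: t_def)
  then have t: "(1 - t) * a + t * 1 = b" "0 \<le> t" "t \<le> 1" by (auto simp: algebra_simps)
  have "(1 - t) * minimax_risk a + t * minimax_risk 1 \<le> minimax_risk ((1 - t) * a + t * 1)"
    using assms t by (intro minimax_risk_concave) auto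
  then show ?thesis unfolding t(1) t_def[symmetric] by (simp add: minimax_risk_1 algebra_simps)
qed

lemma minimax_risk_mono:
  assumes "0 \<le> a" "a \<le> b" "b \<le> 1"
  shows "minimax_risk a \<le> minimax_risk b"
proof (cases "a = b")
  case False
  then have "0 \<le> (b - a) / (1 - a) * (1 - minimax_risk a)"
    using assms minimax_risk_le_1[of a] by auto
  then show ?thesis using minimax_risk_increase[of a b] assms False by simp
qed simp

text \<open>Concavity on \<open>[0, b]\<close> with a nonnegative value at 0 gives
  \<open>a / b * minimax_risk b \<le> minimax_risk a\<close>; the bound 1 on
  \<open>minimax_risk b\<close> does the rest.\<close>

lemma minimax_risk_diff_le:
  assumes "0 \<le> a" "a \<le> b" "0 < b" "b \<le> 1"
  shows "minimax_risk b - minimax_risk a \<le> (b - a) / b"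
proof -
  let ?t = "a / b"
  have t: "0 \<le> ?t" "?t \<le> 1" using assms by auto
  have eq: "(1 - ?t) * 0 + ?t * b = a" using assms by simp
  have "(1 - ?t) * minimax_risk 0 + ?t * minimax_risk b \<le> minimax_risk ((1 - ?t) * 0 + ?t * b)"
    using assms t by (intro minimax_risk_concave) auto
  moreover have "0 \<le> (1 - ?t) * minimax_risk 0"
    using t minimax_risk_nonneg[of 0] by simp
  ultimately have "?t * minimax_risk b \<le> minimax_risk a"
    unfolding eq by linarith
  moreover have "(1 - ?t) * minimax_risk b \<le> (1 - ?t) * 1"
    using t minimax_risk_le_1[of b] assms by (intro mult_left_mono) auto
  moreover have "(b - a) / b = 1 - ?t" using assms by (simp add: diff_divide_distrib)
  ultimately show ?thesis by (simp add: algebra_simps)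
qed

lemma continuous_on_minimax_risk:
  assumes "0 < a"
  shows "continuous_on {a..1} minimax_risk"
proof (rule lipschitz_on_continuous_on)
  have le: "dist (minimax_risk x) (minimax_risk y) \<le> 1 / a * dist x y"
    if "a \<le> x" "x \<le> y" "y \<le> 1" for x y
  proof -
    have "minimax_risk y - minimax_risk x \<le> (y - x) / y"
      using that assms by (intro minimax_risk_diff_le) auto
    also have "\<dots> \<le> (y - x) / a"
      using that assms by (intro divide_left_mono) auto
    finally show ?thesis
      using that assms minimax_risk_mono[of x y] by (simp add: dist_real_def)
  qed
  show "(1 / a)-lipschitz_on {a..1} minimax_risk"
  proof (rule lipschitz_onI)
    fix x y assume "x \<in> {a..1}" "y \<in> {a..1}"
    then show "dist (minimax_risk x) (minimax_risk y) \<le> 1 / a * dist x y"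
      using le[of x y] le[of y x] by (cases "x \<le> y") (auto simp: dist_commute)
  qed (use assms in auto)
qed

text \<open>Where the output is nonzero,
  \<open>(\<bar>z\<bar> - \<tau>) * \<tau> \<le> z\<^sup>2\<close>, so the squared output is at most
  \<open>z ^ 4 / \<tau>\<^sup>2\<close>, and the fourth moment is 3.\<close>

lemma scalar_risk_0_le:
  assumes "0 < \<tau>"
  shows "scalar_risk 0 \<tau> \<le> 3 / \<tau>\<^sup>2"
proof -
  have "(soft_threshold z \<tau>)\<^sup>2 \<le> z ^ 4 / \<tau>\<^sup>2" for z
  proof (cases "\<bar>z\<bar> \<le> \<tau>")
    case True
    then show ?thesis using assms by (simp add: soft_threshold_sq)
  next
    case False
    have "(\<bar>z\<bar> - \<tau>) * \<tau> \<le> \<bar>z\<bar> * \<bar>z\<bar>"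
      using False assms by (intro mult_mono) auto
    then have "((\<bar>z\<bar> - \<tau>) * \<tau>)\<^sup>2 \<le> (\<bar>z\<bar> * \<bar>z\<bar>)\<^sup>2"
      using False assms by (intro power_mono) auto
    also have "\<dots> = z ^ 4" by (simp add: power2_eq_square power4_eq_xxxx)
    finally show ?thesis
      using assms False by (simp add: soft_threshold_sq max_def pos_le_divide_eq power_mult_distrib)
  qed
  then have "scalar_risk 0 \<tau> \<le> (LINT z|std_normal_distribution. z ^ 4 / \<tau>\<^sup>2)"
    unfolding scalar_risk_def
    using assms scalar_risk_integrable[of \<tau> 0] by (intro integral_mono) auto
  then show ?thesis by simp
qed

text \<open>First a threshold large enough to tame the risk at 0, then a sparsity small enough for
  the spike term. This supplies the left endpoint for the intermediate value theorem.\<close>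

lemma minimax_risk_small:
  assumes "0 < c"
  obtains a where "0 < a" "a < 1" "minimax_risk a < c"
proof -
  define \<tau> where "\<tau> = sqrt (6 / c)"
  have \<tau>: "0 < \<tau>" "scalar_risk 0 \<tau> \<le> c / 2"
    using scalar_risk_0_le[of \<tau>] assms by (auto simp: \<tau>_def)
  define a where "a = min (1 / 2) (c / (4 * (1 + \<tau>\<^sup>2)))"
  have p: "0 < 1 + \<tau>\<^sup>2" by (simp add: add_pos_nonneg)
  have a: "0 < a" "a < 1"
    using assms p by (auto simp: a_def)
  have "a \<le> c / (4 * (1 + \<tau>\<^sup>2))" by (simp add: a_def)
  then have "a * (1 + \<tau>\<^sup>2) \<le> c / 4"
    using p by (simp add: field_simps)
  moreover have "(1 - a) * scalar_risk 0 \<tau> \<le> 1 * scalar_risk 0 \<tau>"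
    using a scalar_risk_nonneg by (intro mult_right_mono) auto
  ultimately have "worst_risk a \<tau> < c"
    using \<tau>(2) assms by (simp add: worst_risk_def)
  then show thesis
    using a minimax_risk_le[of a \<tau>] \<tau> by (intro that[of a]) auto
qed

text \<open>Uniqueness is needed to unfold the definite description in \<^const>\<open>rho_MSE\<close>.\<close>

lemma minimax_risk_less_of_less_rho_MSE:
  assumes \<delta>: "0 < \<delta>" "\<delta> < 1" and \<rho>: "0 < \<rho>" "\<rho> < rho_MSE \<delta>"
  shows "\<delta> * \<rho> < 1" "minimax_risk (\<delta> * \<rho>) < \<delta>"
proof -
  obtain a where a: "0 < a" "a < 1" "minimax_risk a < \<delta>"
    using minimax_risk_small[OF \<delta>(1)] .
  obtain e where e: "a \<le> e" "e \<le> 1" "minimax_risk e = \<delta>"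
    using IVT'[of minimax_risk a \<delta> 1] a \<delta> continuous_on_minimax_risk[OF a(1)]
    by (auto simp: minimax_risk_1)
  \<comment> \<open>Once the level \<open>\<delta>\<close> is reached, it is strictly exceeded to
    the right: the chord towards 1 rises, unless the value is already \<open>1 > \<delta>\<close>.
    Hence the level is attained only once.\<close>
  have less: "\<delta> < minimax_risk y" if "0 \<le> x" "x < y" "y \<le> 1" "\<delta> \<le> minimax_risk x" for x y
  proof (cases "minimax_risk x = 1")
    case True
    then show ?thesis using minimax_risk_mono[of x y] that \<delta> by simp
  next
    case False
    then have "0 < (y - x) / (1 - x) * (1 - minimax_risk x)"
      using that minimax_risk_le_1[of x] by (intro mult_pos_pos divide_pos_pos) auto
    then show ?thesis using minimax_risk_increase[of x y] that by simp
  qed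
  have "rho_MSE \<delta> = e / \<delta>"
    unfolding rho_MSE_def
  proof (rule the_equality)
    show "e / \<delta> * \<delta> \<in> {0..1} \<and> minimax_mse (e / \<delta> * \<delta>) = ennreal \<delta>"
      using e a \<delta> by (simp add: minimax_mse_eq)
  next
    fix r assume r: "r * \<delta> \<in> {0..1} \<and> minimax_mse (r * \<delta>) = ennreal \<delta>"
    then have "minimax_risk (r * \<delta>) = \<delta>"
      using \<delta> minimax_risk_nonneg[of "r * \<delta>"] minimax_mse_eq[of "r * \<delta>"] by force
    then have "r * \<delta> = e"
      using less[of "r * \<delta>" e] less[of e "r * \<delta>"] r e a by force
    then show "r = e / \<delta>" using \<delta> by (simp add: field_simps)
  qed
  then have lt: "\<delta> * \<rho> < e"
    using mult_strict_left_mono[OF \<rho>(2) \<delta>(1)] \<delta> by simp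
  then show "\<delta> * \<rho> < 1" using e by simp
  show "minimax_risk (\<delta> * \<rho>) < \<delta>"
    using less[of "\<delta> * \<rho>" e] lt e \<rho> \<delta> by force
qed

text \<open>For moderate thresholds a distant spike nearly realizes \<open>worst_risk\<close>, which
  is at least \<open>minimax_risk\<close>. For large ones the bias on the spike already costs 1,
  again at least \<open>minimax_risk\<close>.\<close>

lemma near_least_favorable_spike:
  assumes "0 < \<epsilon>" "\<epsilon> \<le> 1" "v < minimax_risk \<epsilon>"
  shows "\<exists>\<mu>. \<forall>\<tau>>0. v \<le> (1 - \<epsilon>) * scalar_risk 0 \<tau> + \<epsilon> * scalar_risk \<mu> \<tau>"
proof -
  \<comment> \<open>Solves \<open>\<epsilon> * (T\<^sup>2 / 4 - 1) = 1\<close>.\<close>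
  define T where "T = sqrt (4 * (1 / \<epsilon> + 1))"
  have T: "0 \<le> T" "\<epsilon> * (T\<^sup>2 / 4 - 1) = 1"
    using assms by (auto simp: T_def field_simps)
  obtain \<mu> where \<mu>: "\<And>\<tau>. 0 \<le> \<tau> \<Longrightarrow> \<tau> \<le> T \<Longrightarrow> 1 + \<tau>\<^sup>2 - (minimax_risk \<epsilon> - v) / \<epsilon> \<le> scalar_risk \<mu> \<tau>"
    "\<And>\<tau>. T \<le> \<tau> \<Longrightarrow> T\<^sup>2 / 4 - 1 \<le> scalar_risk \<mu> \<tau>"
    using scalar_risk_spike_uniform[of T "(minimax_risk \<epsilon> - v) / \<epsilon>"] T assms by auto
  show ?thesis
  proof (intro exI[of _ \<mu>] allI impI)
    fix \<tau> :: real
    assume \<tau>: "0 < \<tau>"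
    show "v \<le> (1 - \<epsilon>) * scalar_risk 0 \<tau> + \<epsilon> * scalar_risk \<mu> \<tau>"
    proof (cases "\<tau> \<le> T")
      case True
      have "\<epsilon> * (1 + \<tau>\<^sup>2 - (minimax_risk \<epsilon> - v) / \<epsilon>) \<le> \<epsilon> * scalar_risk \<mu> \<tau>"
        using \<mu>(1)[of \<tau>] \<tau> True assms by (intro mult_left_mono) auto
      moreover have "\<epsilon> * (1 + \<tau>\<^sup>2 - (minimax_risk \<epsilon> - v) / \<epsilon>)
          = \<epsilon> * (1 + \<tau>\<^sup>2) - (minimax_risk \<epsilon> - v)"
        using assms by (simp add: field_simps)
      ultimately show ?thesis
        using minimax_risk_le[of \<epsilon> \<tau>] \<tau> assms by (simp add: worst_risk_def)
    next
      case False
      have "\<epsilon> * (T\<^sup>2 / 4 - 1) \<le> \<epsilon> * scalar_risk \<mu> \<tau>"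
        using \<mu>(2)[of \<tau>] False assms by (intro mult_left_mono) auto
      moreover have "0 \<le> (1 - \<epsilon>) * scalar_risk 0 \<tau>"
        using assms scalar_risk_nonneg by simp
      ultimately show ?thesis
        using T(2) minimax_risk_le_1[of \<epsilon>] assms by linarith
    qed
  qed
qed

section \<open>The minimax threshold and its detection rate\<close>

definition mean_excess :: "real \<Rightarrow> real" where
  "mean_excess \<tau> = (LINT z|std_normal_distribution. max (\<bar>z\<bar> - \<tau>) 0)"

lemma scalar_risk_0_eq:
  "0 \<le> \<tau> \<Longrightarrow> scalar_risk 0 \<tau> = (LINT z|std_normal_distribution. (max (\<bar>z\<bar> - \<tau>) 0)\<^sup>2)"
  by (simp add: scalar_risk_def soft_threshold_sq)

lemma integrable_excess:
  assumes "0 \<le> \<tau>"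
  shows "integrable std_normal_distribution (\<lambda>z. max (\<bar>z\<bar> - \<tau>) 0)"
    and "integrable std_normal_distribution (\<lambda>z. (max (\<bar>z\<bar> - \<tau>) 0)\<^sup>2)"
proof -
  show "integrable std_normal_distribution (\<lambda>z. max (\<bar>z\<bar> - \<tau>) 0)"
    by (intro integrable_max Bochner_Integration.integrable_diff integrable_abs) auto
  show "integrable std_normal_distribution (\<lambda>z. (max (\<bar>z\<bar> - \<tau>) 0)\<^sup>2)"
    using scalar_risk_integrable[OF assms, of 0] assms by (simp add: soft_threshold_sq)
qed

lemma mean_excess_bounds:
  assumes "0 \<le> \<tau>"
  shows "0 \<le> mean_excess \<tau>" "mean_excess \<tau> \<le> 1"
proof -
  show "0 \<le> mean_excess \<tau>" by (simp add: mean_excess_def)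
  have "\<bar>z\<bar> \<le> 1 / 2 + z\<^sup>2 / 2" for z :: real
    using zero_le_power2[of "\<bar>z\<bar> - 1"] by (simp add: power2_eq_square algebra_simps)
  then have "max (\<bar>z\<bar> - \<tau>) 0 \<le> 1 / 2 + z\<^sup>2 / 2" for z :: real
    using assms order_trans[OF abs_ge_zero, of z] by (smt (verit))
  then have "mean_excess \<tau> \<le> (LINT z|std_normal_distribution. 1 / 2 + z\<^sup>2 / 2)"
    unfolding mean_excess_def using assms by (intro integral_mono integrable_excess) auto
  then show "mean_excess \<tau> \<le> 1" by simp
qed

text \<open>
  The derivative of \<open>scalar_risk 0\<close> is \<open>- 2 * mean_excess\<close>; a one-sided quadratic expansion is
  all that continuity and stationarity require.
\<close>

lemma scalar_risk_0_expansion: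
  assumes "0 \<le> \<tau>" "0 \<le> \<tau> + h"
  shows "scalar_risk 0 (\<tau> + h) \<le> scalar_risk 0 \<tau> - 2 * h * mean_excess \<tau> + h\<^sup>2"
proof -
  \<comment> \<open>Expanding the square of \<open>max u 0 - h\<close> pointwise avoids
    differentiating under the integral.\<close>
  have pt: "(max (u - h) 0)\<^sup>2 \<le> (max u 0)\<^sup>2 - 2 * h * max u 0 + h\<^sup>2" for u
  proof -
    have "\<bar>max (u - h) 0\<bar> \<le> \<bar>max u 0 - h\<bar>" by auto
    then have "(max (u - h) 0)\<^sup>2 \<le> (max u 0 - h)\<^sup>2" by (simp only: abs_le_square_iff)
    then show ?thesis by (simp add: power2_eq_square algebra_simps)
  qed
  have "scalar_risk 0 (\<tau> + h) \<le> (LINT z|std_normal_distribution.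
      (max (\<bar>z\<bar> - \<tau>) 0)\<^sup>2 - 2 * h * max (\<bar>z\<bar> - \<tau>) 0 + h\<^sup>2)"
    unfolding scalar_risk_0_eq[OF assms(2)]
    using pt[of "\<bar>_\<bar> - \<tau>"] assms integrable_excess[of \<tau>] integrable_excess[of "\<tau> + h"]
    by (intro integral_mono) (auto simp: diff_diff_eq)
  also have "\<dots> = scalar_risk 0 \<tau> - 2 * h * mean_excess \<tau> + h\<^sup>2"
    using integrable_excess[OF assms(1)] by (simp add: scalar_risk_0_eq[OF assms(1)] mean_excess_def)
  finally show ?thesis .
qed

text \<open>The integrand is the square of a nonnegative convex function of the threshold. Midpoints
  suffice for uniqueness of the minimizer, as the term \<open>\<epsilon> * \<tau>\<^sup>2\<close>
  adds strictness.\<close>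

lemma scalar_risk_0_midpoint:
  assumes "0 \<le> a" "0 \<le> b"
  shows "scalar_risk 0 ((a + b) / 2) \<le> (scalar_risk 0 a + scalar_risk 0 b) / 2"
proof -
  have pt: "(max (c - (a + b) / 2) 0)\<^sup>2 \<le> (max (c - a) 0)\<^sup>2 / 2 + (max (c - b) 0)\<^sup>2 / 2" for c
  proof -
    have "(max (c - (a + b) / 2) 0)\<^sup>2 \<le> ((max (c - a) 0 + max (c - b) 0) / 2)\<^sup>2"
      by (intro power_mono) (auto simp: max_def field_simps)
    also have "\<dots> \<le> (max (c - a) 0)\<^sup>2 / 2 + (max (c - b) 0)\<^sup>2 / 2"
      using zero_le_power2[of "max (c - a) 0 - max (c - b) 0"]
      by (simp add: power2_eq_square field_simps)
    finally show ?thesis .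
  qed
  have "scalar_risk 0 ((a + b) / 2) \<le> (LINT z|std_normal_distribution.
      (max (\<bar>z\<bar> - a) 0)\<^sup>2 / 2 + (max (\<bar>z\<bar> - b) 0)\<^sup>2 / 2)"
    using assms integrable_excess[of a] integrable_excess[of b] integrable_excess[of "(a + b) / 2"] pt
    by (subst scalar_risk_0_eq, simp) (intro integral_mono, auto)
  also have "\<dots> = (scalar_risk 0 a + scalar_risk 0 b) / 2"
    using integrable_excess[OF assms(1)] integrable_excess[OF assms(2)] assms
    by (simp add: scalar_risk_0_eq add_divide_distrib)
  finally show ?thesis .
qed

lemma continuous_on_worst_risk: "continuous_on {0..T} (worst_risk \<epsilon>)"
proof (cases "0 \<le> T")
  case True
  \<comment> \<open>In \<open>2 + T\<close>, the 2 bounds the linear term and \<open>T\<close> the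
    quadratic one. Exchanging \<open>x\<close> and \<open>y\<close> turns the one-sided expansion
    into a Lipschitz bound.\<close>
  have *: "scalar_risk 0 y \<le> scalar_risk 0 x + (2 + T) * \<bar>x - y\<bar>" if "x \<in> {0..T}" "y \<in> {0..T}" for x y
  proof -
    have "scalar_risk 0 y \<le> scalar_risk 0 x - 2 * (y - x) * mean_excess x + (y - x)\<^sup>2"
      using scalar_risk_0_expansion[of x "y - x"] that by simp
    moreover have "\<bar>2 * (y - x) * mean_excess x\<bar> \<le> 2 * \<bar>x - y\<bar> * 1"
      unfolding abs_mult using mean_excess_bounds[of x] that by (intro mult_mono) auto
    moreover have "\<bar>y - x\<bar> * \<bar>y - x\<bar> \<le> T * \<bar>y - x\<bar>"
      using that by (intro mult_right_mono) auto
    then have "(y - x)\<^sup>2 \<le> T * \<bar>x - y\<bar>"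
      by (metis power2_abs power2_eq_square abs_minus_commute)
    ultimately show ?thesis
      by (simp add: algebra_simps)
  qed
  have "(2 + T)-lipschitz_on {0..T} (scalar_risk 0)"
  proof (rule lipschitz_onI)
    fix x y assume "x \<in> {0..T}" "y \<in> {0..T}"
    then show "dist (scalar_risk 0 x) (scalar_risk 0 y) \<le> (2 + T) * dist x y"
      using *[of x y] *[of y x] by (auto simp: dist_real_def abs_minus_commute)
  qed (use True in auto)
  then have "continuous_on {0..T} (scalar_risk 0)"
    by (rule lipschitz_on_continuous_on)
  then show ?thesis
    unfolding worst_risk_def by (intro continuous_intros)
qed simp

text \<open>Existence by compactness: the risk is 1 at threshold 0 and above 1 beyond
  \<open>T\<close>, so a minimum below 1 is interior. Uniqueness by strict convexity.\<close>

lemma ex1_minimax_threshold: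
  assumes "0 < \<epsilon>" "\<epsilon> \<le> 1" "minimax_risk \<epsilon> < 1"
  shows "\<exists>!\<tau>. 0 < \<tau> \<and> worst_risk \<epsilon> \<tau> = minimax_risk \<epsilon>"
proof -
  \<comment> \<open>At this threshold the spike term alone is
    \<open>\<epsilon> + 1 > 1\<close>.\<close>
  define T where "T = sqrt (1 / \<epsilon>)"
  have T: "0 < T" using assms by (simp add: T_def)
  have large: "1 < worst_risk \<epsilon> t" if "T \<le> t" for t
  proof -
    have "T\<^sup>2 \<le> t\<^sup>2" using that T by (intro power_mono) auto
    then have "1 < \<epsilon> * (1 + t\<^sup>2)"
      using assms by (simp add: T_def field_simps)
    moreover have "0 \<le> (1 - \<epsilon>) * scalar_risk 0 t" using assms scalar_risk_nonneg by simp
    ultimately show ?thesis by (simp add: worst_risk_def)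
  qed
  obtain \<tau> where \<tau>: "\<tau> \<in> {0..T}" "\<And>t. t \<in> {0..T} \<Longrightarrow> worst_risk \<epsilon> \<tau> \<le> worst_risk \<epsilon> t"
    using continuous_attains_inf[of "{0..T}" "worst_risk \<epsilon>"] T continuous_on_worst_risk by auto
  obtain t0 where t0: "0 < t0" "worst_risk \<epsilon> t0 < 1"
    using minimax_risk_approx[OF assms(3)] .
  then have lt: "worst_risk \<epsilon> \<tau> < 1"
    using \<tau>(2)[of t0] large[of t0] by force
  have "worst_risk \<epsilon> 0 = 1"
    by (simp add: worst_risk_def scalar_risk_0_eq)
  with lt \<tau> have pos: "0 < \<tau>"
    by (cases "\<tau> = 0") auto
  have "worst_risk \<epsilon> \<tau> \<le> minimax_risk \<epsilon>"
  proof (rule minimax_risk_greatest)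
    fix t :: real assume "0 < t"
    then show "worst_risk \<epsilon> \<tau> \<le> worst_risk \<epsilon> t"
      using \<tau>(2)[of t] large[of t] lt by force
  qed
  then have eq: "worst_risk \<epsilon> \<tau> = minimax_risk \<epsilon>"
    using minimax_risk_le[of \<epsilon> \<tau>] pos assms by simp
  show ?thesis
  proof (rule ex1I[of _ \<tau>])
    fix t assume t: "0 < t \<and> worst_risk \<epsilon> t = minimax_risk \<epsilon>"
    let ?m = "(t + \<tau>) / 2"
    have "(1 - \<epsilon>) * scalar_risk 0 ?m \<le> (1 - \<epsilon>) * ((scalar_risk 0 t + scalar_risk 0 \<tau>) / 2)"
      using scalar_risk_0_midpoint[of t \<tau>] t pos assms by (intro mult_left_mono) auto
    also have "\<dots> = ((1 - \<epsilon>) * scalar_risk 0 t + (1 - \<epsilon>) * scalar_risk 0 \<tau>) / 2"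
      by (simp add: field_simps)
    finally have "(1 - \<epsilon>) * scalar_risk 0 ?m
      \<le> ((1 - \<epsilon>) * scalar_risk 0 t + (1 - \<epsilon>) * scalar_risk 0 \<tau>) / 2" .
    \<comment> \<open>The parallelogram identity provides the strict convexity gap.\<close>
    moreover have "\<epsilon> * (1 + ?m\<^sup>2)
        = (\<epsilon> * (1 + t\<^sup>2) + \<epsilon> * (1 + \<tau>\<^sup>2)) / 2 - \<epsilon> * (t - \<tau>)\<^sup>2 / 4"
      by (simp add: power2_eq_square field_simps)
    \<comment> \<open>Abstract linear form of the sum, so that the products stay unexpanded.\<close>
    moreover have "x + y \<le> ((a + c) + (b + d)) / 2 - e"
      if "x \<le> (a + b) / 2" "y = (c + d) / 2 - e" for x y a b c d e :: real
      using that by (simp add: add_divide_distrib)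
    ultimately have "worst_risk \<epsilon> ?m \<le> (worst_risk \<epsilon> t + worst_risk \<epsilon> \<tau>) / 2 - \<epsilon> * (t - \<tau>)\<^sup>2 / 4"
      unfolding worst_risk_def by metis
    moreover have "minimax_risk \<epsilon> \<le> worst_risk \<epsilon> ?m"
      using minimax_risk_le[of \<epsilon> ?m] pos t assms by simp
    ultimately have "\<epsilon> * (t - \<tau>)\<^sup>2 \<le> 0"
      using t eq by simp
    then show "t = \<tau>"
      using assms by (simp add: mult_le_0_iff)
  qed (use pos eq in simp)
qed

lemma minimax_threshold_props:
  assumes "0 < \<epsilon>" "\<epsilon> \<le> 1" "minimax_risk \<epsilon> < 1"
  shows "0 < minimax_threshold \<epsilon>" "worst_risk \<epsilon> (minimax_threshold \<epsilon>) = minimax_risk \<epsilon>"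
proof -
  have "\<tau> > 0 \<and> (SUP \<nu>\<in>sparse_priors \<epsilon>. mse 1 \<nu> \<tau>) = minimax_mse \<epsilon>
      \<longleftrightarrow> 0 < \<tau> \<and> worst_risk \<epsilon> \<tau> = minimax_risk \<epsilon>" for \<tau>
    using assms worst_risk_nonneg[of \<epsilon> \<tau>] minimax_risk_nonneg[of \<epsilon>]
    by (auto simp: SUP_mse_eq_worst_risk minimax_mse_eq)
  then have "minimax_threshold \<epsilon> = (THE \<tau>. 0 < \<tau> \<and> worst_risk \<epsilon> \<tau> = minimax_risk \<epsilon>)"
    by (simp add: minimax_threshold_def)
  with theI'[OF ex1_minimax_threshold[OF assms]]
  show "0 < minimax_threshold \<epsilon>" "worst_risk \<epsilon> (minimax_threshold \<epsilon>) = minimax_risk \<epsilon>"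
    by auto
qed

text \<open>An upper expansion is enough at a minimum: it forces \<open>0 \<le> h * (c + h)\<close>
  for small \<open>h\<close> of both signs, hence \<open>c = 0\<close>.\<close>

lemma minimizer_stationary:
  assumes "0 \<le> \<epsilon>" "\<epsilon> \<le> 1" "0 < \<tau>" "worst_risk \<epsilon> \<tau> = minimax_risk \<epsilon>"
  shows "\<epsilon> * \<tau> = (1 - \<epsilon>) * mean_excess \<tau>"
proof -
  \<comment> \<open>The derivative of \<open>worst_risk \<epsilon>\<close> at
    \<open>\<tau>\<close>.\<close>
  define c where "c = 2 * (\<epsilon> * \<tau> - (1 - \<epsilon>) * mean_excess \<tau>)"
  have step: "0 \<le> h * (c + h)" if "- \<tau> < h" for h
  proof -
    have "(1 - \<epsilon>) * scalar_risk 0 (\<tau> + h)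
        \<le> (1 - \<epsilon>) * (scalar_risk 0 \<tau> - 2 * h * mean_excess \<tau> + h\<^sup>2)"
      using that assms by (intro mult_left_mono scalar_risk_0_expansion) auto
    then have "worst_risk \<epsilon> (\<tau> + h) \<le> worst_risk \<epsilon> \<tau> + h * (c + h)"
      by (simp add: worst_risk_def c_def power2_eq_square algebra_simps)
    moreover have "worst_risk \<epsilon> \<tau> \<le> worst_risk \<epsilon> (\<tau> + h)"
      using minimax_risk_le[of \<epsilon> "\<tau> + h"] that assms by simp
    ultimately show ?thesis by simp
  qed
  have "c = 0"
  proof (rule ccontr)
    assume "c \<noteq> 0"
    then consider "0 < c" | "c < 0" by linarith
    then show False
    proof cases
      case 1
      \<comment> \<open>The halves keep the step \<open>- k\<close> inside the allowed range and
        \<open>c - k\<close> positive.\<close>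
      define k where "k = min (c / 2) (\<tau> / 2)"
      have k: "0 < k" "k < c" "k < \<tau>" using 1 assms by (auto simp: k_def)
      then have "0 < k * (c - k)" by simp
      with step[of "- k"] k show False by simp
    next
      case 2
      then have "- c / 2 * (c + - c / 2) < 0" by (intro mult_pos_neg) auto
      with step[of "- c / 2"] assms 2 show False by simp
    qed
  qed
  then show ?thesis by (simp add: c_def)
qed

section \<open>Stein's identity and the detection rate\<close>

lemma std_normal_density_has_derivative:
  "(std_normal_density has_real_derivative (- z * std_normal_density z)) (at z)"
  unfolding std_normal_density_def[abs_def]
  by (auto intro!: derivative_eq_intros simp: field_simps)

text \<open>Stein's identity for the positive part of \<open>z - \<tau>\<close>: the integrand has
  antiderivative \<open>- (z - \<tau>) * std_normal_density z\<close>, which vanishes at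
  \<open>\<tau>\<close> and at infinity.\<close>

lemma stein_half_line:
  fixes \<tau> :: real
  defines "h \<equiv> \<lambda>z. indicator {\<tau><..} z * ((z * (z - \<tau>) - 1) * std_normal_density z)"
  shows "integrable lborel h" "(LINT z|lborel. h z) = 0"
proof -
  let ?f = "\<lambda>z. (z * (z - \<tau>) - 1) * std_normal_density z"
  let ?F = "\<lambda>z. - (z - \<tau>) * std_normal_density z"
  have "integrable lborel (\<lambda>z. std_normal_density z * z ^ 2 - \<tau> * (std_normal_density z * z ^ 1)
      - std_normal_density z * z ^ 0)"
    by (intro Bochner_Integration.integrable_diff integrable_mult_right integrable_std_normal_moment)
  then have f: "integrable lborel ?f"
    by (rule Bochner_Integration.integrable_cong[THEN iffD1, rotated 2])
      (auto simp: power2_eq_square algebra_simps)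
  then show h: "integrable lborel h"
    unfolding h_def using integrable_mult_indicator[of "{\<tau><..}" lborel ?f] by simp
  have "(LBINT z=ereal \<tau>..\<infinity>. ?f z) = 0 - 0"
  proof (rule interval_integral_FTC_integrable[where F = ?F])
    fix x
    show "(?F has_vector_derivative ?f x) (at x)"
      unfolding has_real_derivative_iff_has_vector_derivative[symmetric]
      by (auto intro!: derivative_eq_intros std_normal_density_has_derivative simp: algebra_simps)
    show "isCont ?f x"
      by (intro continuous_intros DERIV_isCont[OF std_normal_density_has_derivative])
  next
    show "set_integrable lborel (einterval (ereal \<tau>) \<infinity>) ?f"
      using h by (simp add: set_integrable_def h_def einterval_eq)
    have "(?F \<longlongrightarrow> ?F \<tau>) (at_right \<tau>)"
      by (intro tendsto_intros DERIV_isCont[OF std_normal_density_has_derivative, THEN isCont_tendsto_compose])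
    then show "((?F \<circ> real_of_ereal) \<longlongrightarrow> 0) (at_right (ereal \<tau>))"
      by (simp add: ereal_tendsto_simps)
    have "(?F \<longlongrightarrow> 0) at_top"
      unfolding std_normal_density_def by real_asymp
    then show "((?F \<circ> real_of_ereal) \<longlongrightarrow> 0) (at_left \<infinity>)"
      by (simp add: ereal_tendsto_simps)
  qed simp
  then show "(LINT z|lborel. h z) = 0"
    by (simp add: interval_integral_to_infinity_eq set_lebesgue_integral_def h_def)
qed

text \<open>For an excess \<open>u = \<bar>z\<bar> - \<tau> > 0\<close> one has
  \<open>u\<^sup>2 + \<tau> * u = \<bar>z\<bar> * u\<close>, so the claim is Stein's identity on the
  two half-lines.\<close>

lemma std_normal_tail_eq:
  assumes "0 \<le> \<tau>"
  shows "measure std_normal_distribution {z. \<tau> < \<bar>z\<bar>} = scalar_risk 0 \<tau> + \<tau> * mean_excess \<tau>"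
proof -
  let ?g = "\<lambda>z. (max (\<bar>z\<bar> - \<tau>) 0)\<^sup>2 + \<tau> * max (\<bar>z\<bar> - \<tau>) 0 - indicator {z. \<tau> < \<bar>z\<bar>} z"
  let ?h = "\<lambda>z. indicator {\<tau><..} z * ((z * (z - \<tau>) - 1) * std_normal_density z)"
  have meas: "{z::real. \<tau> < \<bar>z\<bar>} \<in> sets borel" by measurable
  have even: "std_normal_density (- z) = std_normal_density z" for z
    by (simp add: std_normal_density_def)
  have "std_normal_density z * ?g z = ?h z + ?h (- z)" for z
    unfolding even using assms
    by (auto simp: indicator_def max_def abs_if power2_eq_square algebra_simps)
  then have "(LINT z|std_normal_distribution. ?g z) = (LINT z|lborel. ?h z + ?h (- z))"
    by (subst integral_density) auto
  also have "\<dots> = 0"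
    using stein_half_line[of \<tau>] lborel_integrable_real_affine[of ?h "-1" 0]
      lborel_integral_real_affine[of "-1" ?h 0] by simp
  finally have "(LINT z|std_normal_distribution. ?g z) = 0" .
  moreover have "(LINT z|std_normal_distribution. ?g z)
      = scalar_risk 0 \<tau> + \<tau> * mean_excess \<tau> - measure std_normal_distribution {z. \<tau> < \<bar>z\<bar>}"
    using integrable_excess[OF assms] meas
    by (simp add: scalar_risk_0_eq[OF assms] mean_excess_def std_normal.emeasure_eq_measure)
  ultimately show ?thesis by simp
qed

text \<open>Stationarity trades \<open>\<epsilon> * \<tau>\<^sup>2\<close> for
  \<open>(1 - \<epsilon>) * (\<tau> * mean_excess \<tau>)\<close>, which combines with the risk at 0
  into the Gaussian tail.\<close>

lemma minimax_risk_eq_detection_rate: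
  assumes "0 \<le> \<epsilon>" "\<epsilon> \<le> 1" "0 < \<tau>" "worst_risk \<epsilon> \<tau> = minimax_risk \<epsilon>"
  shows "minimax_risk \<epsilon> = (1 - \<epsilon>) * measure std_normal_distribution {z. \<tau> < \<bar>z\<bar>} + \<epsilon>"
proof -
  have "\<epsilon> * \<tau>\<^sup>2 = \<tau> * (\<epsilon> * \<tau>)"
    by (simp add: power2_eq_square)
  also have "\<dots> = (1 - \<epsilon>) * (\<tau> * mean_excess \<tau>)"
    unfolding minimizer_stationary[OF assms] by simp
  finally show ?thesis
    using assms(3) unfolding assms(4)[symmetric] worst_risk_def
    by (simp add: std_normal_tail_eq algebra_simps)
qed

text \<open>A zero signal is detected only if \<open>\<tau> < \<bar>z\<bar>\<close>; a nonzero one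
  is counted as always detected.\<close>

lemma detection_probability_le:
  assumes "0 \<le> \<epsilon>" "0 < s" "0 \<le> \<tau>" "\<nu> \<in> sparse_priors \<epsilon>"
  shows "\<P>((x, z) in signal_noise \<nu>. soft_threshold (x + s * z) (\<tau> * s) \<noteq> 0)
    \<le> (1 - \<epsilon>) * measure std_normal_distribution {z. \<tau> < \<bar>z\<bar>} + \<epsilon>"
proof -
  interpret \<nu>: real_distribution \<nu> using assms by (simp add: sparse_priors_def)
  interpret P: pair_prob_space \<nu> std_normal_distribution ..
  let ?E = "{z::real. \<tau> < \<bar>z\<bar>}"
  have E: "?E \<in> sets std_normal_distribution" by simp
  have times: "measure (\<nu> \<Otimes>\<^sub>M std_normal_distribution) (A \<times> B)
      = measure \<nu> A * measure std_normal_distribution B"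
    if "A \<in> sets \<nu>" "B \<in> sets std_normal_distribution" for A B
    using std_normal.emeasure_pair_measure_Times[OF that] by (simp add: measure_def enn2real_mult)
  define p where "p = measure \<nu> {0}"
  define q where "q = measure std_normal_distribution ?E"
  have "{w \<in> space (signal_noise \<nu>). (case w of (x, z) \<Rightarrow> soft_threshold (x + s * z) (\<tau> * s) \<noteq> 0)}
      \<subseteq> {0} \<times> ?E \<union> (UNIV - {0}) \<times> UNIV"
  proof -
    have "\<tau> < \<bar>z\<bar>" if "soft_threshold (s * z) (\<tau> * s) \<noteq> 0" for z
      using that soft_threshold_scale[OF assms(2), of z \<tau>] assms
      by (auto simp: soft_threshold_def mult.commute split: if_splits)
    then show ?thesis by force
  qed
  then have "\<P>((x, z) in signal_noise \<nu>. soft_threshold (x + s * z) (\<tau> * s) \<noteq> 0)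
      \<le> measure (\<nu> \<Otimes>\<^sub>M std_normal_distribution) ({0} \<times> ?E \<union> (UNIV - {0}) \<times> UNIV)"
    unfolding signal_noise_def using E by (intro P.finite_measure_mono) auto
  also have "\<dots> \<le> measure (\<nu> \<Otimes>\<^sub>M std_normal_distribution) ({0} \<times> ?E)
      + measure (\<nu> \<Otimes>\<^sub>M std_normal_distribution) ((UNIV - {0}) \<times> UNIV)"
    using E by (intro measure_Un_le) auto
  also have "\<dots> = p * q + (1 - p)"
    using E \<nu>.prob_compl[of "{0}"]
    by (simp add: times p_def q_def)
  also have "\<dots> \<le> (1 - \<epsilon>) * q + \<epsilon>"
    using sparse_prior_convex_bound[of q 1 \<epsilon> p] assms
    by (simp add: p_def q_def sparse_priors_def)
  finally show ?thesis by (simp add: q_def)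
qed

section \<open>State evolution\<close>

lemma fMSE_AMPT_le:
  assumes "0 < \<delta>" "0 < \<sigma>" "0 \<le> \<tau>" "\<nu> \<in> sparse_priors \<epsilon>" "0 \<le> \<epsilon>" "\<epsilon> \<le> 1"
    and "worst_risk \<epsilon> \<tau> < \<delta>"
  shows "fMSE_AMPT \<tau> \<delta> \<sigma> \<nu> \<le> ennreal (\<sigma>\<^sup>2 * (worst_risk \<epsilon> \<tau> / (1 - worst_risk \<epsilon> \<tau> / \<delta>)))"
  unfolding fMSE_AMPT_def highest_fixed_point_def
proof (rule Sup_least, clarify)
  fix m :: real
  let ?w = "worst_risk \<epsilon> \<tau>"
  assume m: "0 \<le> m" "ennreal m \<le> mse_map m \<delta> \<sigma> \<tau> \<nu>"
  have pos: "0 < \<sigma>\<^sup>2 + m / \<delta>" using assms m by (intro add_pos_nonneg) auto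
  note m(2)
  also have "mse_map m \<delta> \<sigma> \<tau> \<nu> \<le> ennreal ((\<sigma>\<^sup>2 + m / \<delta>) * ?w)"
    unfolding mse_map_def npi_def using assms pos by (intro mse_le_worst_risk)
  finally have "m \<le> (\<sigma>\<^sup>2 + m / \<delta>) * ?w"
    using pos worst_risk_nonneg[OF assms(5,6)] by (subst (asm) ennreal_le_iff) auto
  then have "m * (1 - ?w / \<delta>) \<le> \<sigma>\<^sup>2 * ?w"
    by (simp add: algebra_simps)
  moreover have "0 < 1 - ?w / \<delta>" using assms by simp
  ultimately show "ennreal m \<le> ennreal (\<sigma>\<^sup>2 * (?w / (1 - ?w / \<delta>)))"
    by (intro ennreal_leI) (simp add: pos_le_divide_eq)
qed

text \<open>
  The spike is placed at the noise level of the target fixed point \<open>v / (1 - v / \<delta>)\<close>. Since the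
  same prior works for all \<open>\<tau>\<close> at once, supremum over priors and infimum over thresholds commute.
\<close>

lemma fMSE_AMPT_near_least_favorable:
  assumes "0 < \<delta>" "0 < \<epsilon>" "\<epsilon> \<le> 1" "0 \<le> v" "v < minimax_risk \<epsilon>" "v < \<delta>"
  obtains \<nu> where "\<nu> \<in> sparse_priors \<epsilon>"
    "\<And>\<tau>. 0 < \<tau> \<Longrightarrow> ennreal (v / (1 - v / \<delta>)) \<le> fMSE_AMPT \<tau> \<delta> 1 \<nu>"
proof -
  \<comment> \<open>The solution of \<open>m = (1 + m / \<delta>) * v\<close>.\<close>
  define m where "m = v / (1 - v / \<delta>)"
  define s2 where "s2 = 1 + m / \<delta>"
  have c: "0 < 1 - v / \<delta>" using assms by simp
  then have m: "0 \<le> m" "0 < s2" using assms by (auto simp: m_def s2_def intro!: add_pos_nonneg)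
  have "m * (1 - v / \<delta>) = v" 
    by (rule nonzero_eq_divide_eq[THEN iffD1, OF _ m_def]) (use c in linarith)
  then have s2: "s2 * v = m" by (simp add: s2_def algebra_simps)
  obtain \<mu> where \<mu>: "\<forall>\<tau>>0. v \<le> (1 - \<epsilon>) * scalar_risk 0 \<tau> + \<epsilon> * scalar_risk \<mu> \<tau>"
    using near_least_favorable_spike[OF assms(2,3,5)] ..
  show thesis
  proof (rule that[of "spike_prior \<epsilon> (sqrt s2 * \<mu>)"])
    show "spike_prior \<epsilon> (sqrt s2 * \<mu>) \<in> sparse_priors \<epsilon>"
      using assms by (intro spike_prior_sparse) auto
    fix \<tau> :: real
    assume \<tau>: "0 < \<tau>"
    have "ennreal m \<le> ennreal (s2 * ((1 - \<epsilon>) * scalar_risk 0 \<tau> + \<epsilon> * scalar_risk \<mu> \<tau>))"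
      using m \<mu> \<tau> by (subst s2[symmetric]) (intro ennreal_leI mult_left_mono, auto)
    also have "\<dots> = mse_map m \<delta> 1 \<tau> (spike_prior \<epsilon> (sqrt s2 * \<mu>))"
      unfolding mse_map_def npi_def using assms m \<tau> mse_spike_prior[of \<epsilon> s2 \<tau> \<mu>]
      by (simp add: s2_def)
    \<comment> \<open>As \<open>highest_fixed_point\<close> is a supremum, a single \<open>m\<close>
      not exceeding its image bounds it from below.\<close>
    finally show "ennreal (v / (1 - v / \<delta>)) \<le> fMSE_AMPT \<tau> \<delta> 1 (spike_prior \<epsilon> (sqrt s2 * \<mu>))"
      unfolding fMSE_AMPT_def highest_fixed_point_def m_def[symmetric] using m
      by (intro Sup_upper) auto
  qed
qed

text \<open>Spikes reach only values \<open>v\<close> strictly below the minimax risk;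
  left-continuity passes the bound to \<open>M\<close>. At \<open>M = 0\<close> no such
  \<open>v\<close> exists, but the bound is trivial.\<close>

lemma ennreal_equilibrium_le:
  fixes M \<delta> :: real
  assumes "0 \<le> M" "M < \<delta>" "\<And>v. 0 \<le> v \<Longrightarrow> v < M \<Longrightarrow> ennreal (v / (1 - v / \<delta>)) \<le> X"
  shows "ennreal (M / (1 - M / \<delta>)) \<le> X"
proof (cases "M = 0")
  case False
  then have M: "0 < M" using assms by simp
  have "((\<lambda>v. ennreal (v / (1 - v / \<delta>))) \<longlongrightarrow> ennreal (M / (1 - M / \<delta>))) (at_left M)"
    using assms M by (intro tendsto_intros tendsto_ennrealI) auto
  moreover have "\<forall>\<^sub>F v in at_left M. ennreal (v / (1 - v / \<delta>)) \<le> X"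
    using eventually_at_left_real[OF M] by eventually_elim (use assms(3) in auto)
  ultimately show ?thesis
    by (rule tendsto_upperbound) simp
qed simp

text \<open>Finiteness keeps \<open>enn2real\<close> from returning 0, so the noise level is
  positive and the detection bound applies.\<close>

lemma EqDR_le:
  assumes "0 < \<delta>" "0 < \<sigma>" "0 \<le> \<tau>" "0 \<le> \<epsilon>" "\<nu> \<in> sparse_priors \<epsilon>" "fMSE_AMPT \<tau> \<delta> \<sigma> \<nu> < \<infinity>"
  shows "EqDR \<tau> \<delta> \<sigma> \<nu> \<le> (1 - \<epsilon>) * measure std_normal_distribution {z. \<tau> < \<bar>z\<bar>} + \<epsilon>"
proof -
  obtain f where f: "0 \<le> f" "fMSE_AMPT \<tau> \<delta> \<sigma> \<nu> = ennreal f"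
    using assms(6) by (cases "fMSE_AMPT \<tau> \<delta> \<sigma> \<nu>") auto
  then have "fNPI \<tau> \<delta> \<sigma> \<nu> = ennreal (\<sigma>\<^sup>2 + f / \<delta>)"
    using assms by (simp add: fNPI_def divide_ennreal)
  moreover have "0 < \<sigma>\<^sup>2 + f / \<delta>" using assms f by (intro add_pos_nonneg) auto
  ultimately have "0 < sqrt (enn2real (fNPI \<tau> \<delta> \<sigma> \<nu>))" by simp
  then show ?thesis
    unfolding EqDR_def eq_threshold_def using assms by (intro detection_probability_le)
qed

theorem proposition4p2:
  fixes \<delta> \<rho> :: real
    and fMSE_LASSO :: "real \<Rightarrow> real \<Rightarrow> real \<Rightarrow> real measure \<Rightarrow> ennreal"
  assumes "0 < \<delta>" and "\<delta> < 1"
    and "0 < \<rho>" and "\<rho> < rho_MSE \<delta>"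
    and "calibration_valid fMSE_LASSO \<delta> \<rho>"
  shows "M_star fMSE_LASSO \<delta> \<rho> = M_flat \<delta> \<rho>
    \<and> M_star fMSE_LASSO \<delta> \<rho> =
        (SUP \<nu>\<in>sparse_priors (\<delta> * \<rho>). fMSE_LASSO (lambda_star \<nu> \<delta> \<rho> 1) \<delta> 1 \<nu>)"
proof -
  define \<epsilon> where "\<epsilon> = \<delta> * \<rho>"
  define M where "M = minimax_risk \<epsilon>"
  define \<tau> where "\<tau> = minimax_threshold \<epsilon>"
  \<comment> \<open>The fixed point of \<open>m = (1 + m / \<delta>) * M\<close>.\<close>
  define g where "g = M / (1 - M / \<delta>)"
  have \<epsilon>: "0 < \<epsilon>" "\<epsilon> \<le> 1" "M < \<delta>"
    using minimax_risk_less_of_less_rho_MSE[OF assms(1-4)] assms by (auto simp: \<epsilon>_def M_def)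
  have M: "0 \<le> M" using minimax_risk_nonneg[of \<epsilon>] \<epsilon> by (simp add: M_def)
  have g: "0 \<le> g" using M \<epsilon> assms by (simp add: g_def)
  have \<tau>: "0 < \<tau>" "worst_risk \<epsilon> \<tau> = M"
    using minimax_threshold_props[of \<epsilon>] \<epsilon> assms by (auto simp: \<tau>_def M_def)
  have upper: "fMSE_AMPT \<tau> \<delta> \<sigma> \<nu> \<le> ennreal (\<sigma>\<^sup>2 * g)" if "0 < \<sigma>" "\<nu> \<in> sparse_priors \<epsilon>" for \<sigma> \<nu>
    using fMSE_AMPT_le[of \<delta> \<sigma> \<tau> \<nu> \<epsilon>] that \<epsilon> \<tau> assms by (simp add: g_def)
  have domain: "\<tau> \<in> calibration_domain \<delta> \<sigma> \<nu>" if "0 < \<sigma>" "\<nu> \<in> sparse_priors \<epsilon>" for \<sigma> \<nu>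
  proof -
    have fin: "fMSE_AMPT \<tau> \<delta> \<sigma> \<nu> < \<infinity>"
      using upper[OF that] by (simp add: le_less_trans)
    then have "EqDR \<tau> \<delta> \<sigma> \<nu> \<le> M"
      using EqDR_le[of \<delta> \<sigma> \<tau> \<epsilon> \<nu>] minimax_risk_eq_detection_rate[of \<epsilon> \<tau>] that \<epsilon> \<tau> assms
      by (simp add: M_def)
    then show ?thesis
      using fin \<tau> \<epsilon> by (simp add: calibration_domain_def)
  qed
  have calibration: "bij_betw (\<lambda>\<tau>. calibrated_lambda \<tau> \<delta> \<sigma> \<nu>) (calibration_domain \<delta> \<sigma> \<nu>) {0..}"
    "\<And>t. t \<in> calibration_domain \<delta> \<sigma> \<nu> \<Longrightarrow>
      fMSE_LASSO (calibrated_lambda t \<delta> \<sigma> \<nu>) \<delta> \<sigma> \<nu> = fMSE_AMPT t \<delta> \<sigma> \<nu>"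
    if "0 < \<sigma>" "\<nu> \<in> sparse_priors \<epsilon>" for \<sigma> \<nu>
    using assms(5) that by (auto simp: calibration_valid_def \<epsilon>_def)
  have lambda_star: "lambda_star \<nu> \<delta> \<rho> \<sigma> = calibrated_lambda \<tau> \<delta> \<sigma> \<nu>" for \<nu> \<sigma>
    by (simp add: lambda_star_def calibrated_lambda_def eq_threshold_def \<tau>_def \<epsilon>_def Let_def)
  have lasso: "fMSE_LASSO (lambda_star \<nu> \<delta> \<rho> \<sigma>) \<delta> \<sigma> \<nu> = fMSE_AMPT \<tau> \<delta> \<sigma> \<nu>"
    "0 \<le> lambda_star \<nu> \<delta> \<rho> \<sigma>" if "0 < \<sigma>" "\<nu> \<in> sparse_priors \<epsilon>" for \<sigma> \<nu>
    using calibration[OF that] domain[OF that] bij_betwE by (fastforce simp: lambda_star)+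
  \<comment> \<open>The prior is chosen before \<open>t\<close>, so the bound survives an infimum
    inside the supremum over priors.\<close>
  have lower: "\<exists>\<nu>\<in>sparse_priors \<epsilon>. \<forall>t>0. ennreal (v / (1 - v / \<delta>)) \<le> fMSE_AMPT t \<delta> 1 \<nu>"
    if "0 \<le> v" "v < M" for v
    using fMSE_AMPT_near_least_favorable[of \<delta> \<epsilon> v] that \<epsilon> assms(1) unfolding M_def
    by (metis order_less_trans)
  have star: "M_star fMSE_LASSO \<delta> \<rho> = ennreal g"
    unfolding M_star_def \<epsilon>_def[symmetric]
  proof (rule antisym)
    show "(SUP \<sigma>\<in>{0<..}. SUP \<nu>\<in>sparse_priors \<epsilon>. INF l\<in>{0..}. fMSE_LASSO l \<delta> \<sigma> \<nu> / ennreal (\<sigma>\<^sup>2))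
        \<le> ennreal g"
    proof (intro SUP_least)
      fix \<sigma> :: real and \<nu>
      assume *: "\<sigma> \<in> {0<..}" "\<nu> \<in> sparse_priors \<epsilon>"
      \<comment> \<open>The single choice \<open>lambda_star\<close> bounds the infimum, and the
        factor \<open>\<sigma>\<^sup>2\<close> cancels.\<close>
      then have "fMSE_LASSO (lambda_star \<nu> \<delta> \<rho> \<sigma>) \<delta> \<sigma> \<nu> / ennreal (\<sigma>\<^sup>2)
          \<le> ennreal (\<sigma>\<^sup>2 * g) / ennreal (\<sigma>\<^sup>2)"
        using upper[of \<sigma> \<nu>] by (simp add: lasso divide_right_mono_ennreal)
      also have "\<dots> = ennreal g"
        using * g by (simp add: divide_ennreal)
      finally show "(INF l\<in>{0..}. fMSE_LASSO l \<delta> \<sigma> \<nu> / ennreal (\<sigma>\<^sup>2)) \<le> ennreal g"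
        using * lasso(2)[of \<sigma> \<nu>] by (intro INF_lower2[of "lambda_star \<nu> \<delta> \<rho> \<sigma>"]) auto
    qed
    show "ennreal g \<le>
        (SUP \<sigma>\<in>{0<..}. SUP \<nu>\<in>sparse_priors \<epsilon>. INF l\<in>{0..}. fMSE_LASSO l \<delta> \<sigma> \<nu> / ennreal (\<sigma>\<^sup>2))"
      unfolding g_def
    proof (rule ennreal_equilibrium_le[OF M \<epsilon>(3)])
      fix v assume "0 \<le> v" "v < M"
      then obtain \<nu> where \<nu>: "\<nu> \<in> sparse_priors \<epsilon>"
        "\<And>t. 0 < t \<Longrightarrow> ennreal (v / (1 - v / \<delta>)) \<le> fMSE_AMPT t \<delta> 1 \<nu>"
        using lower by blast
      have "ennreal (v / (1 - v / \<delta>)) \<le> fMSE_LASSO l \<delta> 1 \<nu> / ennreal (1\<^sup>2)" if "l \<in> {0..}" for l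
      proof -
        \<comment> \<open>Surjectivity of the calibration turns every penalty into a threshold,
          where \<open>lower\<close> applies.\<close>
        have "l \<in> (\<lambda>t. calibrated_lambda t \<delta> 1 \<nu>) ` calibration_domain \<delta> 1 \<nu>"
          using bij_betw_imp_surj_on[OF calibration(1)[OF zero_less_one \<nu>(1)]] that by simp
        then obtain t where t: "t \<in> calibration_domain \<delta> 1 \<nu>" "l = calibrated_lambda t \<delta> 1 \<nu>"
          by (rule imageE)
        then have "0 < t" by (simp add: calibration_domain_def)
        then show ?thesis
          using \<nu> calibration(2)[OF _ \<nu>(1) t(1)] by (simp add: t(2) divide_ennreal_def)
      qed
      then show "ennreal (v / (1 - v / \<delta>)) \<le>
          (SUP \<sigma>\<in>{0<..}. SUP \<nu>\<in>sparse_priors \<epsilon>. INF l\<in>{0..}. fMSE_LASSO l \<delta> \<sigma> \<nu> / ennreal (\<sigma>\<^sup>2))"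
        \<comment> \<open>Noise level 1 already attains the lower bound.\<close>
        using \<nu>(1) by (intro SUP_upper2[of 1] SUP_upper2[of \<nu>] INF_greatest) auto
    qed
  qed
  have flat: "M_flat \<delta> \<rho> = ennreal g"
    unfolding M_flat_def \<epsilon>_def[symmetric]
  proof (rule antisym)
    show "(INF t\<in>{0<..}. SUP \<nu>\<in>sparse_priors \<epsilon>. fMSE_AMPT t \<delta> 1 \<nu>) \<le> ennreal g"
      using \<tau>(1) upper[of 1] by (intro INF_lower2[of \<tau>] SUP_least) auto
    show "ennreal g \<le> (INF t\<in>{0<..}. SUP \<nu>\<in>sparse_priors \<epsilon>. fMSE_AMPT t \<delta> 1 \<nu>)"
      unfolding g_def
    proof (rule ennreal_equilibrium_le[OF M \<epsilon>(3)])
      fix v assume "0 \<le> v" "v < M"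
      then show "ennreal (v / (1 - v / \<delta>)) \<le> (INF t\<in>{0<..}. SUP \<nu>\<in>sparse_priors \<epsilon>. fMSE_AMPT t \<delta> 1 \<nu>)"
        using lower by (intro INF_greatest) (auto intro: SUP_upper2)
    qed
  qed
  have "(SUP \<nu>\<in>sparse_priors \<epsilon>. fMSE_LASSO (lambda_star \<nu> \<delta> \<rho> 1) \<delta> 1 \<nu>)
      = (SUP \<nu>\<in>sparse_priors \<epsilon>. fMSE_AMPT \<tau> \<delta> 1 \<nu>)"
    by (intro SUP_cong) (auto simp: lasso)
  also have "\<dots> = ennreal g"
  proof (rule antisym)
    show "(SUP \<nu>\<in>sparse_priors \<epsilon>. fMSE_AMPT \<tau> \<delta> 1 \<nu>) \<le> ennreal g"
      using upper[of 1] by (intro SUP_least) auto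
    show "ennreal g \<le> (SUP \<nu>\<in>sparse_priors \<epsilon>. fMSE_AMPT \<tau> \<delta> 1 \<nu>)"
      unfolding g_def
    proof (rule ennreal_equilibrium_le[OF M \<epsilon>(3)])
      fix v assume "0 \<le> v" "v < M"
      then show "ennreal (v / (1 - v / \<delta>)) \<le> (SUP \<nu>\<in>sparse_priors \<epsilon>. fMSE_AMPT \<tau> \<delta> 1 \<nu>)"
        using lower \<tau>(1) by (meson SUP_upper2)
    qed
  qed
  finally show ?thesis
    using star flat by (simp add: \<epsilon>_def)
qed

end
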